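(* Let $\mathcal{G}(V,\mathcal{E})$ be a temporal graph with $m=|\mathcal{E}|$ and de-temporal graph $G(V,E)$, query vertex $q$ and teleportation probability $\alpha\in(0,1)$, and let $C$, $r$ and $\widehat{tppr}$ be the output of the algorithm $\textit{Expanding}(\mathcal{G},q,\alpha)$ described in the context. Consider the algorithm $\textit{Reducing}(C,r,\widehat{tppr},q,\alpha)$: 1. Set $R\leftarrow C$, $flag\leftarrow True$, $\widehat\rho(u)\leftarrow\sum_{v\in N_C(u)}\widehat{tppr}(v)$ for $u\in C$, $temp\leftarrow\max_{u\in C}\widehat\rho(u)+\sum_{\vec e}r(\vec e)$, $\bar\epsilon\leftarrow temp/\min_{u\in C}\widehat\rho(u)$. 2. While $flag$: set $Q\leftarrow\emptyset$ (a queue) and $D\leftarrow\emptyset$; for each $u\in R$ with $\bar\epsilon\,\widehat\rho(u)\le temp$, push $u$ into $Q$, and if $u=q$ set $flag\leftarrow False$ and $Q\leftarrow\emptyset$; while $Q\neq\emptyset$: pop $u$, add it to $D$, and for each $v\in N_R(u)$ with $v\notin D$ set $\widehat\rho(v)\leftarrow\widehat\rho(v)-\widehat{tppr}(u)$ and, if $\bar\epsilon\,\widehat\rho(v)\le temp$, push $v$ into $Q$, and if moreover $v=q$ set $flag\leftarrow False$ and $Q\leftarrow\emptyset$; if $flag$ is still $True$, set $\epsilon\leftarrow\bar\epsilon$, $R\leftarrow R\setminus D$, $\bar\epsilon\leftarrow\bar\epsilon/2$. 3. Return $\epsilon$ and $CC(R,q)$, the vertex set of the maximal connected component of $G_R$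 containing $q$. Then the time complexity of this algorithm is $O(|G_C|\log m)$ and its space complexity is $O(|G_C|)$, where $|G_C|$ denotes the size of $G_C=\{(u,v)\in E: u,v\in C\}$.
   Context: A temporal graph $\mathcal{G}(V,\mathcal{E})$ has temporal edges $(u,v,t)$; its de-temporal graph $G(V,E)$ has $E=\{(u,v):(u,v,t)\in\mathcal{E}\}$; $G_S$ is the subgraph induced by $S$, and $N_S(u)=\{v\in S:(u,v)\in E\}$. Each temporal edge $(u,v,t)$ yields ordered temporal edges $\langle u,v,t\rangle,\langle v,u,t\rangle$ with $head(\langle u,v,t\rangle)=u$, $tail=v$, $time=t$; $N^{>}(\vec e)=\{\langle u,v,t\rangle:u=tail(\vec e),t>time(\vec e)\}$, $\vec e^{\,out}_u=\{\vec e:head(\vec e)=u\}$; $P(\vec e_i\to\vec e_j)=\frac{1/(time(\vec e_j)-time(\vec e_i))}{\sum_{\vec e_k\in N^{>}(\vec e_i)}1/(time(\vec e_k)-time(\vec e_i))}$ for $\vec e_j\in N^{>}(\vec e_i)$, $0$ otherwise. The algorithm $\textit{Expanding}(\mathcal{G},q,\alpha)$: initialize $r(\vec e)=1/|\vec e^{\,out}_q|$ for $\vec e\in\vec e^{\,out}_q$ (else $0$), $\pi\equiv0$, $\widehat{tppr}\equiv0$, $C=\emptyset$, $\widehat\beta=0$, queue $Q=(q)$, $D=\{q\}$; while $Q\ne\emptyset$: pop $u$, add $u$ to $C$, call $\textit{Propagation}(\vec e)$ for each $\vec e\in\vec e^{\,out}_u$, update $\widehat\beta\leftarrow\max(\widehat\beta,\min_{w\in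 C}\sum_{v\in N_C(w)}\widehat{tppr}(v))$, for each unvisited $v\in N_V(u)$ add $v$ to $D$ and push it into $Q$ if $\sum_{\vec e}r(\vec e)+\sum_{w\in N_V(v)}\widehat{tppr}(w)\ge\widehat\beta$, and if $\sum_{\vec e}r(\vec e)+\sum_{w\in Q}\widehat{tppr}(w)<\widehat\beta$ set $C\leftarrow C\cup Q$ and stop; return $C,r,\widehat{tppr}$. Here $\textit{Propagation}(\vec e)$, when $r(\vec e)\ge1/m$, adds $(1-\alpha)r(\vec e)P(\vec e\to\vec e_1)$ to $r(\vec e_1)$ for each $\vec e_1\in N^{>}(\vec e)$, adds $\alpha r(\vec e)$ to $\pi(\vec e)$ and to $\widehat{tppr}(tail(\vec e))$, and sets $r(\vec e)=0$.
   Formalization: As written the time bound fails; proved for Reducing where a vertex already in Q is not pushed again and where the sum of r(e) is given as one number (its evaluation and the storage of r are not charged), with adjacency lists of G_C as input and q having at least one temporal edge. *)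

theory Defs
  imports Complex_Main
begin

section \<open>Temporal graphs\<close>

text \<open>
  Edges are undirected: a temporal edge is an unordered pair of vertices with a time stamp, and
  each one yields two ordered temporal edges (a single one for a loop, which is not excluded).
\<close>

record 'v temporal_graph =
  verts :: "'v set"
  tedges :: "('v set \<times> real) set"

definition wf_temporal_graph :: "'v temporal_graph \<Rightarrow> bool" where
  "wf_temporal_graph G \<longleftrightarrow> finite (verts G) \<and> finite (tedges G) \<and>
     (\<forall>(e, t) \<in> tedges G. \<exists>u \<in> verts G. \<exists>v \<in> verts G. e = {u, v})"

definition edges :: "'v temporal_graph \<Rightarrow> 'v set set" where
  "edges G = fst ` tedges G"

definition induced_edges :: "'v temporal_graph \<Rightarrow> 'v set \<Rightarrow> 'v set set" where
  "induced_edges G S = {e \<in> edges G. e \<subseteq> S}"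

definition nbrs :: "'v temporal_graph \<Rightarrow> 'v set \<Rightarrow> 'v \<Rightarrow> 'v set" where
  "nbrs G S u = {v \<in> S. {u, v} \<in> edges G}"

type_synonym 'v oedge = "'v \<times> 'v \<times> real"

definition ordered_edges :: "'v temporal_graph \<Rightarrow> 'v oedge set" where
  "ordered_edges G = {(u, v, t) | u v t. ({u, v}, t) \<in> tedges G}"

definition ehead :: "'v oedge \<Rightarrow> 'v" where "ehead e = fst e"
definition etail :: "'v oedge \<Rightarrow> 'v" where "etail e = fst (snd e)"
definition etime :: "'v oedge \<Rightarrow> real" where "etime e = snd (snd e)"

definition later :: "'v temporal_graph \<Rightarrow> 'v oedge \<Rightarrow> 'v oedge set" where
  "later G e = {f \<in> ordered_edges G. ehead f = etail e \<and> etime f > etime e}"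

definition out_edges :: "'v temporal_graph \<Rightarrow> 'v \<Rightarrow> 'v oedge set" where
  "out_edges G u = {e \<in> ordered_edges G. ehead e = u}"

definition trans_prob :: "'v temporal_graph \<Rightarrow> 'v oedge \<Rightarrow> 'v oedge \<Rightarrow> real" where
  "trans_prob G e f =
     (if f \<in> later G e
      then (1 / (etime f - etime e)) / (\<Sum>g \<in> later G e. 1 / (etime g - etime e))
      else 0)"


section \<open>The algorithm Expanding\<close>

record 'v expand_state =
  x_res :: "'v oedge \<Rightarrow> real"
  x_pi :: "'v oedge \<Rightarrow> real"
  x_tppr :: "'v \<Rightarrow> real"
  x_C :: "'v set"
  x_beta :: real
  x_queue :: "'v list"
  x_visited :: "'v set"

definition expand_init :: "'v temporal_graph \<Rightarrow> 'v \<Rightarrow> 'v expand_state" where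
  "expand_init G q =
     \<lparr>x_res = (\<lambda>e. if e \<in> out_edges G q then 1 / real (card (out_edges G q)) else 0),
      x_pi = (\<lambda>_. 0), x_tppr = (\<lambda>_. 0), x_C = {}, x_beta = 0,
      x_queue = [q], x_visited = {q}\<rparr>"

definition propagation ::
  "'v temporal_graph \<Rightarrow> real \<Rightarrow> 'v oedge \<Rightarrow> 'v expand_state \<Rightarrow> 'v expand_state" where
  "propagation G \<alpha> e s =
     (if x_res s e \<ge> 1 / real (card (tedges G))
      then s\<lparr>x_res := (\<lambda>f. if f = e then 0
                     else if f \<in> later G e
                     then x_res s f + (1 - \<alpha>) * x_res s e * trans_prob G e f
                     else x_res s f),
             x_pi := (x_pi s)(e := x_pi s e + \<alpha> * x_res s e),
             x_tppr := (x_tppr s)(etail e := x_tppr s (etail e) + \<alpha> * x_res s e)\<rparr>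
      else s)"

definition total_res :: "'v temporal_graph \<Rightarrow> ('v oedge \<Rightarrow> real) \<Rightarrow> real" where
  "total_res G r = (\<Sum>e \<in> ordered_edges G. r e)"

definition update_beta :: "'v temporal_graph \<Rightarrow> 'v expand_state \<Rightarrow> 'v expand_state" where
  "update_beta G s = s\<lparr>x_beta := max (x_beta s)
     (Min ((\<lambda>w. \<Sum>v \<in> nbrs G (x_C s) w. x_tppr s v) ` x_C s))\<rparr>"

definition visit :: "'v temporal_graph \<Rightarrow> 'v \<Rightarrow> 'v expand_state \<Rightarrow> 'v expand_state" where
  "visit G v s =
     s\<lparr>x_visited := insert v (x_visited s),
       x_queue := (if total_res G (x_res s) + (\<Sum>w \<in> nbrs G (verts G) v. x_tppr s w) \<ge> x_beta s
                   then x_queue s @ [v] else x_queue s)\<rparr>"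

text \<open>The early stop is rendered by emptying the queue, which ends the loop.\<close>

definition check_stop :: "'v temporal_graph \<Rightarrow> 'v expand_state \<Rightarrow> 'v expand_state" where
  "check_stop G s =
     (if total_res G (x_res s) + (\<Sum>w \<in> set (x_queue s). x_tppr s w) < x_beta s
      then s\<lparr>x_C := x_C s \<union> set (x_queue s), x_queue := []\<rparr>
      else s)"

text \<open>
  One iteration of the main loop. The lists \<open>es\<close> and \<open>vs\<close> are arbitrary enumerations of the sets
  that the two inner loops range over, so no particular order is assumed.
\<close>

inductive expand_iter ::
  "'v temporal_graph \<Rightarrow> real \<Rightarrow> 'v expand_state \<Rightarrow> 'v expand_state \<Rightarrow> bool"
  for G :: "'v temporal_graph" and \<alpha> :: real where
  "\<lbrakk> x_queue s = u # us;
     distinct es; set es = out_edges G u;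
     distinct vs; set vs = nbrs G (verts G) u - x_visited s;
     s1 = fold (propagation G \<alpha>) es (s\<lparr>x_queue := us, x_C := insert u (x_C s)\<rparr>);
     s2 = fold (visit G) vs (update_beta G s1) \<rbrakk>
   \<Longrightarrow> expand_iter G \<alpha> s (check_stop G s2)"

definition expanding_output ::
  "'v temporal_graph \<Rightarrow> 'v \<Rightarrow> real \<Rightarrow> 'v set \<Rightarrow> ('v oedge \<Rightarrow> real) \<Rightarrow> ('v \<Rightarrow> real) \<Rightarrow> bool" where
  "expanding_output G q \<alpha> C r tppr \<longleftrightarrow>
     (\<exists>s. (expand_iter G \<alpha>)\<^sup>*\<^sup>* (expand_init G q) s \<and> x_queue s = [] \<and>
          C = x_C s \<and> r = x_res s \<and> tppr = x_tppr s)"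


section \<open>Programs and their cost\<close>

text \<open>
  A small imperative language whose small-step semantics is the cost model: running time is the
  number of steps. Programs below use \<open>Basic\<close> and \<open>Cond\<close>/\<open>While\<close> tests only for operations of
  constant cost on a RAM with unit-cost real arithmetic: reading or writing one scalar or one
  table entry, inserting, deleting or looking up one element of a set, and operations at the ends
  of a queue.

  \<open>For A body\<close> evaluates \<open>A\<close> once and then runs \<open>body\<close> on its elements in an arbitrary order
  (\<open>Iter\<close> is the loop under way). An infinite \<open>A\<close> gives a diverging loop, so that \<open>Skip\<close> is the
  only command without a successor and a bound on the number of steps implies termination.
\<close>

datatype ('v, 's) com =
    Skip
  | Basic "'s \<Rightarrow> 's"
  | Seq "('v, 's) com" "('v, 's) com"  (infixr \<open>;;\<close> 60)
  | Cond "'s \<Rightarrow> bool" "('v, 's) com" "('v, 's) com"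
  | While "'s \<Rightarrow> bool" "('v, 's) com"
  | For "'s \<Rightarrow> 'v set" "'v \<Rightarrow> ('v, 's) com"
  | Iter "'v list" "'v \<Rightarrow> ('v, 's) com"

inductive step :: "('v, 's) com \<times> 's \<Rightarrow> ('v, 's) com \<times> 's \<Rightarrow> bool" where
  step_Basic: "step (Basic f, s) (Skip, f s)"
| step_Seq_Skip: "step (Skip ;; c, s) (c, s)"
| step_Seq: "step (c1, s) (c1', s') \<Longrightarrow> step (c1 ;; c2, s) (c1' ;; c2, s')"
| step_Cond: "step (Cond b c1 c2, s) (if b s then c1 else c2, s)"
| step_While: "step (While b c, s) (if b s then c ;; While b c else Skip, s)"
| step_For: "distinct xs \<Longrightarrow> set xs = A s \<Longrightarrow> step (For A body, s) (Iter xs body, s)"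
| step_For_infinite: "infinite (A s) \<Longrightarrow> step (For A body, s) (For A body, s)"
| step_Iter_Nil: "step (Iter [] body, s) (Skip, s)"
| step_Iter_Cons: "step (Iter (x # xs) body, s) (body x ;; Iter xs body, s)"

lemma step_progress: "c \<noteq> Skip \<Longrightarrow> \<exists>cfg. step (c, s) cfg"
proof (induction c arbitrary: s)
  case (Seq c1 c2)
  show ?case
  proof (cases "c1 = Skip")
    case True
    then show ?thesis by (blast intro: step_Seq_Skip)
  next
    case False
    from Seq.IH(1)[OF False, of s] obtain c1' s' where "step (c1, s) (c1', s')" by auto
    then show ?thesis by (blast intro: step_Seq)
  qed
next
  case (For A body)
  show ?case
  proof (cases "finite (A s)")
    case True
    then obtain xs where "set xs = A s" "distinct xs"
      using finite_distinct_list by blast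
    then show ?thesis by (blast intro: step_For)
  next
    case False
    then show ?thesis by (blast intro: step_For_infinite)
  qed
next
  case (Iter xs body)
  show ?case by (cases xs) (blast intro: step_Iter_Nil step_Iter_Cons)+
qed (blast intro: step.intros)+

definition runs_in_time :: "('v, 's) com \<Rightarrow> 's \<Rightarrow> real \<Rightarrow> bool" where
  "runs_in_time c s T \<longleftrightarrow> (\<forall>n cfg. (step ^^ n) (c, s) cfg \<longrightarrow> real n \<le> T)"

definition runs_in_space :: "('s \<Rightarrow> nat) \<Rightarrow> ('v, 's) com \<Rightarrow> 's \<Rightarrow> real \<Rightarrow> bool" where
  "runs_in_space cells c s M \<longleftrightarrow> (\<forall>c' s'. step\<^sup>*\<^sup>* (c, s) (c', s') \<longrightarrow> real (cells s') \<le> M)"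


section \<open>The algorithm Reducing\<close>

text \<open>
  The input consists of \<open>C\<close>, the adjacency lists of the graph induced by \<open>C\<close>, the values of
  \<open>tppr\<close> on \<open>C\<close>, and the total residual, a number that Expanding already evaluates in its
  stopping test.
\<close>

record 'v reduce_state =
  R :: "'v set"
  rho :: "'v \<rightharpoonup> real"
  hi :: real
  lo :: real
  temp :: real
  eps_bar :: real
  eps :: "real option"
  flag :: bool
  queue :: "'v list"
  D :: "'v set"
  cur :: 'v
  comp :: "'v set"

text \<open>\<open>eps\<close> is \<open>None\<close> as long as it has not been assigned.\<close>

definition reduce_init :: "'v \<Rightarrow> 'v reduce_state" where
  "reduce_init q =
     \<lparr>R = {}, rho = Map.empty, hi = 0, lo = 0, temp = 0, eps_bar = 0, eps = None, flag = True,
      queue = [], D = {}, cur = q, comp = {}\<rparr>"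

definition clear_queue :: "('v, 'v reduce_state) com" where
  "clear_queue = While (\<lambda>s. queue s \<noteq> []) (Basic (\<lambda>s. s\<lparr>queue := tl (queue s)\<rparr>))"

text \<open>
  A vertex already waiting in the queue is not entered a second time; the membership test is one
  bit per vertex. With duplicates a vertex would be processed, and its value subtracted from its
  neighbours, several times per round, and the linear cost of a round would be lost.
\<close>

definition push :: "'v \<Rightarrow> ('v, 'v reduce_state) com" where
  "push v = Cond (\<lambda>s. v \<in> set (queue s)) Skip (Basic (\<lambda>s. s\<lparr>queue := queue s @ [v]\<rparr>))"

definition pop :: "('v, 'v reduce_state) com" where
  "pop = Basic (\<lambda>s. s\<lparr>cur := hd (queue s), queue := tl (queue s)\<rparr>)"

definition push_if_low :: "'v \<Rightarrow> 'v \<Rightarrow> ('v, 'v reduce_state) com" where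
  "push_if_low q v =
     Cond (\<lambda>s. eps_bar s * the (rho s v) \<le> temp s)
       (push v ;;
        Cond (\<lambda>_. v = q) (Basic (\<lambda>s. s\<lparr>flag := False\<rparr>) ;; clear_queue) Skip)
       Skip"

text \<open>
  Maximum and minimum start from the value at \<open>q\<close>, which belongs to \<open>C\<close>. If the minimum is
  \<open>0\<close>, the quotient \<open>eps_bar\<close> is \<open>0\<close> by the convention \<open>x / 0 = 0\<close>.
\<close>

definition reduce_setup ::
  "'v temporal_graph \<Rightarrow> 'v set \<Rightarrow> ('v oedge \<Rightarrow> real) \<Rightarrow> ('v \<Rightarrow> real) \<Rightarrow> 'v
     \<Rightarrow> ('v, 'v reduce_state) com" where
  "reduce_setup G C r tppr q =
     For (\<lambda>_. C) (\<lambda>u. Basic (\<lambda>s. s\<lparr>R := insert u (R s)\<rparr>)) ;;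
     Basic (\<lambda>s. s\<lparr>flag := True\<rparr>) ;;
     For (\<lambda>_. C) (\<lambda>u.
       Basic (\<lambda>s. s\<lparr>rho := (rho s)(u \<mapsto> 0)\<rparr>) ;;
       For (\<lambda>_. nbrs G C u) (\<lambda>v.
         Basic (\<lambda>s. s\<lparr>rho := (rho s)(u \<mapsto> the (rho s u) + tppr v)\<rparr>))) ;;
     Basic (\<lambda>s. s\<lparr>hi := the (rho s q), lo := the (rho s q)\<rparr>) ;;
     For (\<lambda>_. C) (\<lambda>u.
       Basic (\<lambda>s. s\<lparr>hi := max (hi s) (the (rho s u)), lo := min (lo s) (the (rho s u))\<rparr>)) ;;
     Basic (\<lambda>s. s\<lparr>temp := hi s + total_res G r\<rparr>) ;;
     Basic (\<lambda>s. s\<lparr>eps_bar := temp s / lo s\<rparr>)"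

text \<open>
  Iterating over the neighbours of a vertex in \<open>R\<close> means scanning its adjacency list in the graph
  induced by \<open>C\<close> and testing each entry.
\<close>

definition reduce_loop ::
  "'v temporal_graph \<Rightarrow> 'v set \<Rightarrow> ('v \<Rightarrow> real) \<Rightarrow> 'v \<Rightarrow> ('v, 'v reduce_state) com" where
  "reduce_loop G C tppr q =
     While flag
       (clear_queue ;;
        For D (\<lambda>u. Basic (\<lambda>s. s\<lparr>D := D s - {u}\<rparr>)) ;;
        For R (push_if_low q) ;;
        While (\<lambda>s. queue s \<noteq> [])
          (pop ;;
           Basic (\<lambda>s. s\<lparr>D := insert (cur s) (D s)\<rparr>) ;;
           For (\<lambda>s. nbrs G C (cur s)) (\<lambda>v.
             Cond (\<lambda>s. v \<in> R s \<and> v \<notin> D s)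
               (Basic (\<lambda>s. s\<lparr>rho := (rho s)(v \<mapsto> the (rho s v) - tppr (cur s))\<rparr>) ;;
                push_if_low q v)
               Skip)) ;;
        Cond flag
          (Basic (\<lambda>s. s\<lparr>eps := Some (eps_bar s)\<rparr>) ;;
           For D (\<lambda>u. Basic (\<lambda>s. s\<lparr>R := R s - {u}\<rparr>)) ;;
           Basic (\<lambda>s. s\<lparr>eps_bar := eps_bar s / 2\<rparr>))
          Skip)"

text \<open>
  Breadth-first search from \<open>q\<close> in the graph induced by \<open>R\<close>; on exit \<open>comp\<close> is the vertex set of
  the connected component containing \<open>q\<close>.
\<close>

definition reduce_component ::
  "'v temporal_graph \<Rightarrow> 'v set \<Rightarrow> 'v \<Rightarrow> ('v, 'v reduce_state) com" where
  "reduce_component G C q =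
     clear_queue ;;
     push q ;;
     Basic (\<lambda>s. s\<lparr>comp := {q}\<rparr>) ;;
     While (\<lambda>s. queue s \<noteq> [])
       (pop ;;
        For (\<lambda>s. nbrs G C (cur s)) (\<lambda>v.
          Cond (\<lambda>s. v \<in> R s \<and> v \<notin> comp s)
            (Basic (\<lambda>s. s\<lparr>comp := insert v (comp s)\<rparr>) ;; push v)
            Skip))"

definition reducing ::
  "'v temporal_graph \<Rightarrow> 'v set \<Rightarrow> ('v oedge \<Rightarrow> real) \<Rightarrow> ('v \<Rightarrow> real) \<Rightarrow> 'v
     \<Rightarrow> ('v, 'v reduce_state) com" where
  "reducing G C r tppr q =
     reduce_setup G C r tppr q ;; reduce_loop G C tppr q ;; reduce_component G C q"

text \<open>
  Memory cells in use. Input: \<open>C\<close> and \<open>tppr\<close> on it, the adjacency lists, \<open>q\<close> and the total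
  residual. Working memory: the data structures of the state, its seven scalars, and one iterator
  for each of the at most two nested \<open>For\<close> loops under way.
\<close>

definition reduce_cells ::
  "'v temporal_graph \<Rightarrow> 'v set \<Rightarrow> 'v reduce_state \<Rightarrow> nat" where
  "reduce_cells G C s =
     (2 * card C + (\<Sum>u \<in> C. card (nbrs G C u)) + 2) +
     (card (R s) + card (dom (rho s)) + length (queue s) + card (D s) + card (comp s) + 7 + 2)"

text \<open>
  Some temporal edge must be incident to \<open>q\<close>: the initial residual \<open>1 / card (out_edges G q)\<close>
  is meaningless otherwise.
\<close>

definition reducing_input ::
  "'v temporal_graph \<Rightarrow> 'v \<Rightarrow> real \<Rightarrow> 'v set \<Rightarrow> ('v oedge \<Rightarrow> real) \<Rightarrow> ('v \<Rightarrow> real) \<Rightarrow> bool" where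
  "reducing_input G q \<alpha> C r tppr \<longleftrightarrow>
     wf_temporal_graph G \<and> q \<in> verts G \<and> out_edges G q \<noteq> {} \<and> 0 < \<alpha> \<and> \<alpha> < 1 \<and>
     expanding_output G q \<alpha> C r tppr"

end

theory Submission
  imports Defs
begin

text \<open>
  Since every vertex enters the queue of Expanding through an edge to \<open>C\<close>, the graph induced by
  \<open>C\<close> has at least \<open>card C - 1\<close> edges, and at least one because some edge is incident to \<open>q\<close>.
  Hence \<open>C\<close> and its adjacency lists have size linear in the number of induced edges.
  A round of Reducing takes each vertex from the queue at most once, so it costs linear time;
  clearing the queue is paid for by the pushes.

  The bound on \<open>eps_bar\<close> alone would give a number of rounds depending on \<open>\<alpha>\<close>. But
  \<open>eps_bar\<close> is \<open>temp / lo / 2 ^ k\<close> in round \<open>k\<close>, and the value at \<open>q\<close> never increases, so the loop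
  stops as soon as \<open>2 ^ k\<close> reaches \<open>rho q / lo\<close> for the initial \<open>rho\<close>. Each propagation adds at most
  \<open>\<alpha>\<close> to \<open>tppr\<close> in total and at least \<open>\<alpha> / m\<close> to one entry, and there are at most \<open>2 * m\<close> of them,
  so this ratio is at most \<open>2 * m\<^sup>2\<close> whatever \<open>\<alpha>\<close> is. If \<open>lo = 0\<close>, then \<open>eps_bar = 0\<close> and the first
  round is the last.
\<close>


section \<open>A program logic with time credits\<close>

text \<open>
  \<open>wp I Q T c s\<close>: with \<open>T\<close> credits, one per step, every run of \<open>c\<close> from \<open>s\<close> can be paid for, stays
  within \<open>I\<close>, and ends with the remaining credits and the final state related by \<open>Q\<close>. Time and
  space bounds are read off the same judgement.
\<close>

inductive wp :: "('s \<Rightarrow> bool) \<Rightarrow> (nat \<Rightarrow> 's \<Rightarrow> bool) \<Rightarrow> nat \<Rightarrow> ('v, 's) com \<Rightarrow> 's \<Rightarrow> bool"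
  for I :: "'s \<Rightarrow> bool" and Q :: "nat \<Rightarrow> 's \<Rightarrow> bool" where
  wpI: "\<lbrakk>I s; c = Skip \<longrightarrow> Q T s;
     \<And>c' s'. step (c, s) (c', s') \<Longrightarrow> \<exists>T'. T = Suc T' \<and> wp I Q T' c' s'\<rbrakk> \<Longrightarrow> wp I Q T c s"

inductive_cases step_SkipE: "step (Skip, s) cfg"
inductive_cases step_BasicE: "step (Basic f, s) cfg"
inductive_cases step_SeqE: "step (c1 ;; c2, s) cfg"
inductive_cases step_CondE: "step (Cond b c1 c2, s) cfg"
inductive_cases step_WhileE: "step (While b c, s) cfg"
inductive_cases step_ForE: "step (For A body, s) cfg"
inductive_cases step_IterE: "step (Iter xs body, s) cfg"

lemma wp_invariant: "wp I Q T c s \<Longrightarrow> I s"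
  by (auto elim: wp.cases)

lemma wp_stepD:
  assumes "wp I Q T c s" "step (c, s) (c', s')"
  shows "\<exists>T'. T = Suc T' \<and> wp I Q T' c' s'"
  using assms(1) by (rule wp.cases) (use assms(2) in blast)

text \<open>Each step strips one credit and keeps \<open>I\<close>; credits are natural numbers, so
  no run can have more than \<open>T\<close> steps.\<close>

lemma wp_steps:
  assumes "wp I Q T c s" "(step ^^ n) (c, s) (c', s')"
  shows "n \<le> T \<and> I s'"
  using assms
proof (induction n arbitrary: T c s)
  case 0
  then show ?case by (auto dest: wp_invariant)
next
  case (Suc n)
  from Suc.prems(2) obtain c1 s1 where st: "step (c, s) (c1, s1)"
    and rest: "(step ^^ n) (c1, s1) (c', s')"
    by (metis relpowp_Suc_D2 surj_pair)
  from wp_stepD[OF Suc.prems(1) st] obtain T' where "T = Suc T'" "wp I Q T' c1 s1" by blast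
  with Suc.IH rest show ?case by fastforce
qed

lemma wp_runs_in_time: "wp I Q T c s \<Longrightarrow> runs_in_time c s (real T)"
  unfolding runs_in_time_def by (auto dest: wp_steps)

lemma wp_runs_in_space:
  assumes "wp I Q T c s" "\<And>s'. I s' \<Longrightarrow> real (cells s') \<le> M"
  shows "runs_in_space cells c s M"
  unfolding runs_in_space_def
proof (intro allI impI)
  fix c' s' assume "step\<^sup>*\<^sup>* (c, s) (c', s')"
  then obtain n where "(step ^^ n) (c, s) (c', s')" by (auto dest: rtranclp_imp_relpowp)
  with wp_steps[OF assms(1)] assms(2) show "real (cells s') \<le> M" by blast
qed

text \<open>Frame and consequence rule in one: the surplus \<open>T - a\<close> travels untouched
  through the run of \<open>c\<close> and is added to what \<open>c\<close> leaves over. Each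
  command can thus be verified once, with its own budget.\<close>

lemma wp_call:
  assumes "wp I Q a c s" "a \<le> T" "\<And>p s'. I s' \<Longrightarrow> Q p s' \<Longrightarrow> Q' (T - a + p) s'"
  shows "wp I Q' T c s"
  using assms
proof (induction a c s arbitrary: T rule: wp.induct)
  case (wpI s c a)
  show ?case
  proof (rule wp.wpI)
    show "I s" by (rule wpI)
    show "c = Skip \<longrightarrow> Q' T s"
      using wpI.hyps(1,2) wpI.prems by fastforce
    fix c' s' assume "step (c, s) (c', s')"
    from wpI.IH[OF this] obtain b where b: "a = Suc b"
      and ih: "\<And>T. b \<le> T \<Longrightarrow> (\<And>p s'. I s' \<Longrightarrow> Q p s' \<Longrightarrow> Q' (T - b + p) s') \<Longrightarrow> wp I Q' T c' s'"
      by blast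
    from b wpI.prems(1) obtain T' where T': "T = Suc T'" "b \<le> T'" by (cases T) auto
    have "wp I Q' T' c' s'"
      using ih[OF T'(2)] wpI.prems(2) b T' by simp
    with T' show "\<exists>T'. T = Suc T' \<and> wp I Q' T' c' s'" by blast
  qed
qed

section \<open>Proof rules for the commands\<close>

lemma wp_Skip: "I s \<Longrightarrow> Q T s \<Longrightarrow> wp I Q T Skip s"
  by (rule wpI) (auto elim: step_SkipE)

lemma wp_Basic: "I s \<Longrightarrow> I (f s) \<Longrightarrow> 1 \<le> T \<Longrightarrow> Q (T - 1) (f s) \<Longrightarrow> wp I Q T (Basic f) s"
  by (rule wpI) (cases T; auto elim!: step_BasicE intro: wp_Skip)+

text \<open>The credit demanded between the two commands pays for the step that discards the
  finished \<open>Skip\<close>.\<close>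

lemma wp_Seq:
  assumes "wp I (\<lambda>T' s'. 1 \<le> T' \<and> wp I Q (T' - 1) c2 s') T c1 s"
  shows "wp I Q T (c1 ;; c2) s"
  using assms
proof (induction T c1 s rule: wp.induct)
  case (wpI s c T)
  show ?case
  proof (rule wp.wpI)
    fix c' s' assume "step (c ;; c2, s) (c', s')"
    then show "\<exists>T'. T = Suc T' \<and> wp I Q T' c' s'"
    proof (rule step_SeqE)
      assume "(c', s') = (c2, s)" "c = Skip"
      with wpI.hyps show ?thesis by (cases T) auto
    next
      fix c1' s1 assume "(c', s') = (c1' ;; c2, s1)" "step (c, s) (c1', s1)"
      with wpI.IH show ?thesis by blast
    qed
  qed (use wpI in auto)
qed

lemma wp_Cond:
  "\<lbrakk>I s; 1 \<le> T; \<And>T'. T = Suc T' \<Longrightarrow> b s \<Longrightarrow> wp I Q T' c1 s;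
    \<And>T'. T = Suc T' \<Longrightarrow> \<not> b s \<Longrightarrow> wp I Q T' c2 s\<rbrakk>
   \<Longrightarrow> wp I Q T (Cond b c1 c2) s"
  by (rule wpI) (cases T; auto elim!: step_CondE)+

text \<open>The balance is an equation without truncated subtraction, so that budgets fall to linear
  arithmetic.\<close>

lemma wp_Seq_call:
  assumes "wp I P a c1 s" "a + 1 \<le> T"
    and "\<And>p t T'. I t \<Longrightarrow> P p t \<Longrightarrow> T' + a + 1 = T + p \<Longrightarrow> wp I Q T' c2 t"
  shows "wp I Q T (c1 ;; c2) s"
  by (rule wp_Seq, rule wp_call[OF assms(1)]) (use assms(2,3) in auto)

lemma wp_Seq_Basic:
  assumes "I s" "I (f s)" "2 \<le> T" "\<And>T'. T' + 2 = T \<Longrightarrow> wp I Q T' c (f s)"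
  shows "wp I Q T (Basic f ;; c) s"
  by (rule wp_Seq_call[where a = 1 and P = "\<lambda>p t. p = 0 \<and> t = f s"]) (use assms in \<open>auto intro: wp_Basic\<close>)

text \<open>Credits double as the termination measure: every iteration spends some, so induction on
  \<open>T\<close> replaces a variant.\<close>

lemma wp_While:
  assumes "I s" "Inv T s"
    and pos: "\<And>T s. I s \<Longrightarrow> Inv T s \<Longrightarrow> 1 \<le> T"
    and body: "\<And>T s. I s \<Longrightarrow> Inv T s \<Longrightarrow> b s \<Longrightarrow>
                 wp I (\<lambda>T' s'. 1 \<le> T' \<and> Inv (T' - 1) s') (T - 1) c s"
    and exit: "\<And>T s. I s \<Longrightarrow> Inv T s \<Longrightarrow> \<not> b s \<Longrightarrow> Q (T - 1) s"
  shows "wp I Q T (While b c) s"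
  using assms(1,2)
proof (induction T arbitrary: s rule: less_induct)
  case (less T)
  from pos[OF less.prems] obtain T0 where T0: "T = Suc T0" by (cases T) auto
  \<comment> \<open>An inner induction follows the run of the body. When it reaches
    \<open>Skip\<close>, the outer hypothesis applies, because the credits have dropped below
    \<open>T\<close>.\<close>
  have body_steps: "wp I Q T' (c' ;; While b c) s'"
    if "wp I (\<lambda>T' s'. 1 \<le> T' \<and> Inv (T' - 1) s') T' c' s'" "T' < T" for T' c' s'
    using that
  proof (induction T' c' s' rule: wp.induct)
    case (wpI s' c' T')
    show ?case
    proof (rule wp.wpI)
      fix c'' s'' assume "step (c' ;; While b c, s') (c'', s'')"
      then show "\<exists>T0. T' = Suc T0 \<and> wp I Q T0 c'' s''"
      proof (rule step_SeqE)
        assume "(c'', s'') = (While b c, s')" "c' = Skip"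
        with wpI.hyps wpI.prems less.IH[of "T' - 1" s'] show ?thesis by (cases T') auto
      next
        fix c1' s1 assume "(c'', s'') = (c1' ;; While b c, s1)" "step (c', s') (c1', s1)"
        with wpI.IH wpI.prems show ?thesis by fastforce
      qed
    qed (use wpI in auto)
  qed
  show ?case
  proof (rule wp.wpI)
    fix c' s' assume "step (While b c, s) (c', s')"
    then have "(c', s') = (if b s then c ;; While b c else Skip, s)"
      by (auto elim: step_WhileE)
    then show "\<exists>T'. T = Suc T' \<and> wp I Q T' c' s'"
      using body[OF less.prems] body_steps[of T0 c s] exit[OF less.prems] less.prems T0
      by (auto intro: wp_Skip split: if_splits)
  qed (use less.prems in auto)
qed

text \<open>The order of the list is arbitrary, so \<open>Inv\<close> sees only the set
  \<open>X\<close> of elements already passed.\<close>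

lemma wp_Iter:
  assumes "I s" "Inv X T s" "distinct xs" "X \<inter> set xs = {}"
    and pos: "\<And>X T s. I s \<Longrightarrow> Inv X T s \<Longrightarrow> 1 \<le> T"
    and body: "\<And>X x T s. I s \<Longrightarrow> Inv X T s \<Longrightarrow> x \<in> A \<Longrightarrow> x \<notin> X \<Longrightarrow>
                 wp I (\<lambda>T' s'. 1 \<le> T' \<and> Inv (insert x X) (T' - 1) s') (T - 1) (body x) s"
    and exit: "\<And>T s. I s \<Longrightarrow> Inv A T s \<Longrightarrow> Q (T - 1) s"
    and A: "A = X \<union> set xs"
  shows "wp I Q T (Iter xs body) s"
  using assms(1-4) A
proof (induction xs arbitrary: X T s)
  case Nil
  from pos[OF Nil(1,2)] obtain T0 where T0: "T = Suc T0" by (cases T) auto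
  have "wp I Q T0 Skip s"
    using Nil exit[of s T] T0 by (auto intro: wp_Skip)
  then show ?case
    by (intro wpI) (use Nil.prems T0 in \<open>auto elim!: step_IterE\<close>)
next
  case (Cons x xs)
  from pos[OF Cons.prems(1,2)] obtain T0 where T0: "T = Suc T0" by (cases T) auto
  have "wp I Q T0 (body x ;; Iter xs body) s"
  proof (rule wp_Seq, rule wp_call[where a = T0])
    show "wp I (\<lambda>T' s'. 1 \<le> T' \<and> Inv (insert x X) (T' - 1) s') T0 (body x) s"
      using body[OF Cons.prems(1,2), of x] Cons.prems T0 by auto
    fix p s' assume "I s'" "1 \<le> p \<and> Inv (insert x X) (p - 1) s'"
    then show "1 \<le> T0 - T0 + p \<and> wp I Q (T0 - T0 + p - 1) (Iter xs body) s'"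
      using Cons.IH[of s' "insert x X" "p - 1"] Cons.prems by auto
  qed simp
  then show ?case
    by (intro wpI) (use Cons.prems T0 in \<open>auto elim!: step_IterE\<close>)
qed

text \<open>
  The potential \<open>\<phi>\<close> carries credits from one pass of the body to later ones; \<open>b x\<close> is the amortised
  cost of the pass for \<open>x\<close>.
\<close>

lemma wp_For:
  fixes b :: "'v \<Rightarrow> nat" and \<phi> :: "'s \<Rightarrow> nat" and body :: "'v \<Rightarrow> ('v, 's) com"
  assumes "I s" "finite (A s)" "J {} s"
    and T: "\<phi> s + (\<Sum>x\<in>A s. b x + 2) + 2 \<le> T"
    and body: "\<And>X x t. I t \<Longrightarrow> J X t \<Longrightarrow> X \<subseteq> A s \<Longrightarrow> x \<in> A s \<Longrightarrow> x \<notin> X \<Longrightarrow>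
                 wp I (\<lambda>p t'. \<phi> t' \<le> p \<and> J (insert x X) t') (\<phi> t + b x) (body x) t"
    and exit: "\<And>p t. I t \<Longrightarrow> J (A s) t \<Longrightarrow>
                 T - (\<phi> s + (\<Sum>x\<in>A s. b x + 2) + 2) + \<phi> t \<le> p \<Longrightarrow> Q p t"
  shows "wp I Q T (For A body) s"
proof (rule wpI)
  \<comment> \<open>\<open>k\<close> is the surplus over the budget. Of each \<open>b x + 2\<close>,
    one credit unfolds \<open>Iter\<close> and one discards the \<open>Skip\<close> after the body;
    the final 2 pay for entering the loop and for the empty \<open>Iter\<close>.\<close>
  define k where "k = T - (\<phi> s + (\<Sum>x\<in>A s. b x + 2) + 2)"
  have Tk: "T = Suc (k + \<phi> s + (\<Sum>x\<in>A s. b x + 2) + 1)" using T by (simp add: k_def)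
  fix c' s' assume "step (For A body, s) (c', s')"
  with \<open>finite (A s)\<close> obtain xs where xs: "distinct xs" "set xs = A s"
    and [simp]: "c' = Iter xs body" "s' = s"
    by (auto elim: step_ForE)
  have "wp I Q (k + \<phi> s + (\<Sum>x\<in>A s. b x + 2) + 1) (Iter xs body) s"
  proof (rule wp_Iter[where A = "A s" and X = "{}" and
        Inv = "\<lambda>X T t. X \<subseteq> A s \<and> J X t \<and> k + \<phi> t + (\<Sum>x\<in>A s - X. b x + 2) + 1 \<le> T"])
    fix X x T' t
    assume It: "I t" and inv: "X \<subseteq> A s \<and> J X t \<and> k + \<phi> t + (\<Sum>x\<in>A s - X. b x + 2) + 1 \<le> T'"
      and x: "x \<in> A s" "x \<notin> X"
    have split: "(\<Sum>x\<in>A s - X. b x + 2) = b x + 2 + (\<Sum>x\<in>A s - insert x X. b x + 2)"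
      using x \<open>finite (A s)\<close> sum.remove[of "A s - X" x "\<lambda>x. b x + 2"]
      by (simp add: Diff_insert[symmetric])
    from inv x have "wp I (\<lambda>p t'. \<phi> t' \<le> p \<and> J (insert x X) t') (\<phi> t + b x) (body x) t"
      by (intro body It) auto
    then show "wp I (\<lambda>T' t'. 1 \<le> T' \<and> insert x X \<subseteq> A s \<and> J (insert x X) t' \<and>
        k + \<phi> t' + (\<Sum>x\<in>A s - insert x X. b x + 2) + 1 \<le> T' - 1) (T' - 1) (body x) t"
      by (rule wp_call) (use inv x split in auto)
  next
    fix T' t assume "I t" "A s \<subseteq> A s \<and> J (A s) t \<and> k + \<phi> t + (\<Sum>x\<in>A s - A s. b x + 2) + 1 \<le> T'"
    then show "Q (T' - 1) t" by (intro exit) (auto simp: k_def)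
  qed (use assms xs in auto)
  then show "\<exists>T'. T = Suc T' \<and> wp I Q T' c' s'" using Tk by auto
qed (use assms in auto)


section \<open>The output of Expanding\<close>

text \<open>After a choice of endpoints \<open>a x\<close>, \<open>b x\<close>, every ordered edge
  is one of the two orientations of its temporal edge. For a loop these coincide, hence an
  inequality.\<close>

lemma finite_ordered_edges:
  assumes "wf_temporal_graph G"
  shows "finite (ordered_edges G)" and "card (ordered_edges G) \<le> 2 * card (tedges G)"
proof -
  have "\<forall>x\<in>tedges G. \<exists>u v. fst x = {u, v}"
    using assms unfolding wf_temporal_graph_def by fastforce
  then obtain a b where ab: "\<And>x. x \<in> tedges G \<Longrightarrow> {a x, b x} = fst x" by metis
  let ?f = "\<lambda>x. (a x, b x, snd x)" and ?g = "\<lambda>x. (b x, a x, snd x)"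
  have sub: "ordered_edges G \<subseteq> ?f ` tedges G \<union> ?g ` tedges G"
  proof
    fix e assume "e \<in> ordered_edges G"
    then obtain u v t where e: "e = (u, v, t)" "({u, v}, t) \<in> tedges G"
      by (auto simp: ordered_edges_def)
    then have "{a ({u, v}, t), b ({u, v}, t)} = {u, v}" using ab[of "({u, v}, t)"] by simp
    then have "e = ?f ({u, v}, t) \<or> e = ?g ({u, v}, t)"
      using e(1) by (auto simp: doubleton_eq_iff)
    then show "e \<in> ?f ` tedges G \<union> ?g ` tedges G" using e(2) by blast
  qed
  have fin: "finite (tedges G)" using assms by (simp add: wf_temporal_graph_def)
  then show "finite (ordered_edges G)" using sub by (meson finite_Un finite_imageI finite_subset)
  have "card (ordered_edges G) \<le> card (?f ` tedges G \<union> ?g ` tedges G)"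
    using sub fin by (intro card_mono) auto
  also have "\<dots> \<le> card (?f ` tedges G) + card (?g ` tedges G)" by (rule card_Un_le)
  also have "\<dots> \<le> card (tedges G) + card (tedges G)"
    using fin by (intro add_mono card_image_le)
  finally show "card (ordered_edges G) \<le> 2 * card (tedges G)" by simp
qed

lemma out_edges_subset: "out_edges G u \<subseteq> ordered_edges G"
  and later_subset: "later G e \<subseteq> ordered_edges G"
  by (auto simp: out_edges_def later_def)

lemma nbrs_subset: "nbrs G S u \<subseteq> S"
  by (auto simp: nbrs_def)

lemma edges_subset_verts: "wf_temporal_graph G \<Longrightarrow> e \<in> edges G \<Longrightarrow> e \<subseteq> verts G"
  unfolding wf_temporal_graph_def edges_def by fastforce

lemma finite_edges: "wf_temporal_graph G \<Longrightarrow> finite (edges G)"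
  unfolding wf_temporal_graph_def edges_def by simp

lemma finite_induced_edges: "wf_temporal_graph G \<Longrightarrow> finite (induced_edges G S)"
  unfolding induced_edges_def by (simp add: finite_edges)

lemma edge_of_ordered: "(u, v, t) \<in> ordered_edges G \<Longrightarrow> {u, v} \<in> edges G"
  unfolding ordered_edges_def edges_def by (force simp: doubleton_eq_iff)

text \<open>Out-edge sets of distinct vertices are disjoint, because the head determines the
  vertex.\<close>

lemma sum_card_out_edges:
  assumes "wf_temporal_graph G" "finite S"
  shows "(\<Sum>u\<in>S. card (out_edges G u)) \<le> 2 * card (tedges G)"
proof -
  have "(\<Sum>u\<in>S. card (out_edges G u)) = card (\<Union>u\<in>S. out_edges G u)"
    using finite_ordered_edges(1)[OF assms(1)] assms(2)
    by (intro card_UN_disjoint[symmetric])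
       (auto simp: out_edges_def intro: finite_subset[rotated])
  also have "\<dots> \<le> card (ordered_edges G)"
    using finite_ordered_edges(1)[OF assms(1)] out_edges_subset[of G]
    by (intro card_mono) blast+
  finally show ?thesis using finite_ordered_edges(2)[OF assms(1)] by linarith
qed

text \<open>Handshake count: the adjacent pairs in \<open>S\<close> are orientations of induced
  edges, at most two for each.\<close>

lemma sum_card_nbrs:
  assumes "wf_temporal_graph G" "finite S"
  shows "(\<Sum>u\<in>S. card (nbrs G S u)) \<le> 2 * card (induced_edges G S)"
proof -
  let ?E = "induced_edges G S" and ?P = "Sigma S (nbrs G S)"
  have finE: "finite ?E" by (rule finite_induced_edges[OF assms(1)])
  have fn: "finite (nbrs G S u)" for u using assms(2) nbrs_subset by (rule finite_subset[rotated])
  have "\<forall>e\<in>?E. \<exists>u v. e = {u, v}"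
    using assms(1) unfolding wf_temporal_graph_def induced_edges_def edges_def by fastforce
  then obtain a b where ab: "\<And>x. x \<in> ?E \<Longrightarrow> x = {a x, b x}" by metis
  let ?f = "\<lambda>x. (a x, b x)" and ?g = "\<lambda>x. (b x, a x)"
  have sub: "?P \<subseteq> ?f ` ?E \<union> ?g ` ?E"
  proof
    fix p assume "p \<in> ?P"
    then obtain u v where p: "p = (u, v)" "{u, v} \<in> ?E"
      by (auto simp: nbrs_def induced_edges_def)
    then have "p = ?f {u, v} \<or> p = ?g {u, v}"
      using ab[OF p(2)] by (auto simp: doubleton_eq_iff)
    then show "p \<in> ?f ` ?E \<union> ?g ` ?E" using p(2) by blast
  qed
  have "(\<Sum>u\<in>S. card (nbrs G S u)) = card ?P"
    using assms(2) fn by (simp add: card_SigmaI)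
  also have "\<dots> \<le> card (?f ` ?E \<union> ?g ` ?E)" using sub finE by (intro card_mono) auto
  also have "\<dots> \<le> card (?f ` ?E) + card (?g ` ?E)" by (rule card_Un_le)
  also have "\<dots> \<le> card ?E + card ?E" using finE by (intro add_mono card_image_le)
  finally show ?thesis by simp
qed

section \<open>Residual mass and granularity of \<open>tppr\<close>\<close>

text \<open>The gap between 0 and \<open>\<alpha> / m\<close> reflects the threshold
  \<open>1 / m\<close> below which no propagation happens. \<open>B\<close> is a parameter because
  it grows with each propagation.\<close>

definition mass_bounded :: "'v temporal_graph \<Rightarrow> real \<Rightarrow> real \<Rightarrow> 'v expand_state \<Rightarrow> bool" where
  "mass_bounded G \<alpha> B s \<longleftrightarrow>
     (\<forall>e. 0 \<le> x_res s e) \<and> total_res G (x_res s) \<le> 1 \<and>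
     (\<forall>v. x_tppr s v = 0 \<or> \<alpha> / card (tedges G) \<le> x_tppr s v) \<and>
     (\<Sum>v\<in>verts G. x_tppr s v) \<le> B"

text \<open>The sum is a quotient of a number by itself: 1, or 0 by the convention for division by 0
  when there is no later edge.\<close>

lemma sum_trans_prob_le_1:
  assumes "wf_temporal_graph G"
  shows "(\<Sum>f\<in>later G e. trans_prob G e f) \<le> 1"
proof -
  have "(\<Sum>f\<in>later G e. trans_prob G e f) =
      (\<Sum>f\<in>later G e. 1 / (etime f - etime e)) / (\<Sum>g\<in>later G e. 1 / (etime g - etime e))"
    unfolding sum_divide_distrib by (rule sum.cong) (auto simp: trans_prob_def)
  then show ?thesis by simp
qed

lemma trans_prob_nonneg: "0 \<le> trans_prob G e f"
proof -
  have "0 \<le> 1 / (etime g - etime e)" if "g \<in> later G e" for g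
    using that by (simp add: later_def)
  moreover from this have "0 \<le> (\<Sum>g\<in>later G e. 1 / (etime g - etime e))"
    by (rule sum_nonneg)
  ultimately show ?thesis
    unfolding trans_prob_def by (simp only: divide_nonneg_nonneg split: if_split) simp
qed

text \<open>The edge loses its residual and at most the fraction \<open>1 - \<alpha>\<close> of it
  is handed on, so the total does not grow. A single residual lies between the threshold and that
  total, hence \<open>tppr\<close> gains at least \<open>\<alpha> / m\<close> and at most
  \<alpha>.\<close>

lemma mass_bounded_propagation:
  assumes wf: "wf_temporal_graph G" and \<alpha>: "0 < \<alpha>" "\<alpha> < 1" and e: "e \<in> ordered_edges G"
    and s: "mass_bounded G \<alpha> B s"
  shows "mass_bounded G \<alpha> (B + \<alpha>) (propagation G \<alpha> e s)"
proof (cases "x_res s e \<ge> 1 / real (card (tedges G))")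
  case False
  with s \<alpha> show ?thesis by (auto simp: mass_bounded_def propagation_def)
next
  case True
  define r' where "r' = (\<lambda>f. if f = e then 0
      else if f \<in> later G e then x_res s f + (1 - \<alpha>) * x_res s e * trans_prob G e f else x_res s f)"
  define t' where "t' = (x_tppr s)(etail e := x_tppr s (etail e) + \<alpha> * x_res s e)"
  have eq: "x_res (propagation G \<alpha> e s) = r'" "x_tppr (propagation G \<alpha> e s) = t'"
    using True by (auto simp: propagation_def r'_def t'_def)
  have finO: "finite (ordered_edges G)" by (rule finite_ordered_edges[OF wf])
  have nn: "0 \<le> x_res s f" for f using s unfolding mass_bounded_def by blast
  \<comment> \<open>Later edges have strictly larger times, so resetting \<open>e\<close> and
    distributing its residual never touch the same entry.\<close>
  have enl: "e \<notin> later G e" by (simp add: later_def)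
  have r'nn: "0 \<le> r' f" for f
    using nn \<alpha> trans_prob_nonneg[of G e] by (auto simp: r'_def)
  have "total_res G r' = (\<Sum>f\<in>ordered_edges G.
      (if f = e then 0 else x_res s f) + (if f \<in> later G e then (1 - \<alpha>) * x_res s e * trans_prob G e f else 0))"
    unfolding total_res_def r'_def using enl by (intro sum.cong) auto
  also have "\<dots> = (total_res G (x_res s) - x_res s e) + (1 - \<alpha>) * x_res s e * (\<Sum>f\<in>later G e. trans_prob G e f)"
  proof -
    have "(\<Sum>f\<in>ordered_edges G. if f = e then 0 else x_res s f) = total_res G (x_res s) - x_res s e"
      using finO e by (simp add: total_res_def sum.remove[OF finO e] if_distrib)
    moreover have "(\<Sum>f\<in>ordered_edges G. if f \<in> later G e then (1 - \<alpha>) * x_res s e * trans_prob G e f else 0)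
        = (1 - \<alpha>) * x_res s e * (\<Sum>f\<in>later G e. trans_prob G e f)"
      using finO later_subset[of G e]
      by (simp add: sum.inter_restrict[symmetric] Int_absorb1 sum_distrib_left)
    ultimately show ?thesis by (simp add: sum.distrib)
  qed
  also have "\<dots> \<le> total_res G (x_res s)"
  proof -
    have "(1 - \<alpha>) * x_res s e * (\<Sum>f\<in>later G e. trans_prob G e f) \<le> (1 - \<alpha>) * x_res s e * 1"
      using sum_trans_prob_le_1[OF wf] nn[of e] \<alpha> by (intro mult_left_mono) auto
    also have "\<dots> \<le> x_res s e" using nn[of e] \<alpha> by (simp add: mult_left_le_one_le)
    finally show ?thesis by simp
  qed
  finally have tot: "total_res G r' \<le> 1" using s by (simp add: mass_bounded_def)
  have re1: "x_res s e \<le> 1"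
    using member_le_sum[OF e, of "x_res s"] nn finO s by (auto simp: total_res_def mass_bounded_def)
  have t'lb: "t' v = 0 \<or> \<alpha> / card (tedges G) \<le> t' v" for v
  proof -
    have "\<alpha> / card (tedges G) \<le> \<alpha> * x_res s e"
      using mult_left_mono[OF True, of \<alpha>] \<alpha> by simp
    moreover have "x_tppr s v = 0 \<or> \<alpha> / card (tedges G) \<le> x_tppr s v"
      using s by (simp add: mass_bounded_def)
    moreover have "0 \<le> \<alpha> / card (tedges G)" using \<alpha> by simp
    ultimately show ?thesis by (auto simp: t'_def)
  qed
  have tailv: "etail e \<in> verts G"
    using e edges_subset_verts[OF wf] edge_of_ordered[of _ _ _ G]
    by (cases e) (fastforce simp: etail_def)
  have finV: "finite (verts G)" using wf by (simp add: wf_temporal_graph_def)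
  have "(\<Sum>v\<in>verts G. t' v) = (\<Sum>v\<in>verts G. x_tppr s v + (if v = etail e then \<alpha> * x_res s e else 0))"
    by (intro sum.cong) (auto simp: t'_def)
  also have "\<dots> = (\<Sum>v\<in>verts G. x_tppr s v) + \<alpha> * x_res s e"
    using finV tailv by (simp add: sum.distrib)
  also have "\<dots> \<le> B + \<alpha>"
    using s re1 \<alpha> by (auto simp: mass_bounded_def mult_left_le intro!: add_mono)
  finally show ?thesis using tot r'nn t'lb by (simp add: mass_bounded_def eq)
qed

lemma mass_bounded_fold_propagation:
  assumes "wf_temporal_graph G" "0 < \<alpha>" "\<alpha> < 1" "set es \<subseteq> ordered_edges G" "mass_bounded G \<alpha> B s"
  shows "mass_bounded G \<alpha> (B + \<alpha> * length es) (fold (propagation G \<alpha>) es s)"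
  using assms
proof (induction es arbitrary: B s)
  case (Cons e es)
  have "mass_bounded G \<alpha> ((B + \<alpha>) + \<alpha> * length es) (fold (propagation G \<alpha>) es (propagation G \<alpha> e s))"
    using Cons.prems by (intro Cons.IH mass_bounded_propagation) auto
  then show ?case by (simp add: algebra_simps)
qed simp

lemma propagation_frame:
  "x_C (fold (propagation G \<alpha>) es s) = x_C s"
  "x_queue (fold (propagation G \<alpha>) es s) = x_queue s"
  "x_visited (fold (propagation G \<alpha>) es s) = x_visited s"
  "x_beta (fold (propagation G \<alpha>) es s) = x_beta s"
  by (induction es arbitrary: s) (auto simp: propagation_def)

lemma visit_frame:
  "x_C (fold (visit G) vs s) = x_C s"
  "x_res (fold (visit G) vs s) = x_res s"
  "x_tppr (fold (visit G) vs s) = x_tppr s"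
  by (induction vs arbitrary: s) (auto simp: visit_def)

section \<open>Connectivity of the expanded set\<close>

text \<open>The last conjunct is the spanning tree bound for processed and waiting vertices
  together. The conjuncts before it ensure that no vertex waits twice or returns after it has been
  processed.\<close>

definition frontier :: "'v temporal_graph \<Rightarrow> 'v \<Rightarrow> 'v expand_state \<Rightarrow> bool" where
  "frontier G q s \<longleftrightarrow>
     finite (x_C s) \<and> distinct (x_queue s) \<and> set (x_queue s) \<inter> x_C s = {} \<and>
     x_C s \<union> set (x_queue s) \<subseteq> x_visited s \<and> q \<in> x_C s \<union> set (x_queue s) \<and>
     card (x_C s \<union> set (x_queue s)) \<le> card (induced_edges G (x_C s \<union> set (x_queue s))) + 1"

lemma card_induced_edges_insert:
  assumes "wf_temporal_graph G" "u \<in> S" "v \<notin> S" "{u, v} \<in> edges G"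
  shows "Suc (card (induced_edges G S)) \<le> card (induced_edges G (insert v S))"
proof -
  have "{u, v} \<notin> induced_edges G S" using assms by (auto simp: induced_edges_def)
  then have "Suc (card (induced_edges G S)) = card (insert {u, v} (induced_edges G S))"
    using finite_induced_edges[OF assms(1)] by simp
  also have "\<dots> \<le> card (induced_edges G (insert v S))"
    using finite_induced_edges[OF assms(1)] assms
    by (intro card_mono) (auto simp: induced_edges_def)
  finally show ?thesis .
qed

text \<open>If \<open>v\<close> is pushed, it brings the new edge to \<open>u\<close>, so both sides
  of the tree bound grow; if it is rejected, only the visited set changes.\<close>

lemma frontier_visit:
  assumes "wf_temporal_graph G" "frontier G q s" "u \<in> x_C s" "{u, v} \<in> edges G" "v \<notin> x_visited s"
  shows "frontier G q (visit G v s)"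
proof -
  let ?S = "x_C s \<union> set (x_queue s)"
  have "Suc (card (induced_edges G ?S)) \<le> card (induced_edges G (insert v ?S))"
    using assms by (intro card_induced_edges_insert[of G u]) (auto simp: frontier_def)
  moreover have "v \<notin> ?S" "finite ?S" using assms by (auto simp: frontier_def)
  moreover have "card ?S \<le> card (induced_edges G ?S) + 1" using assms by (simp add: frontier_def)
  ultimately have "card (insert v ?S) \<le> card (induced_edges G (insert v ?S)) + 1" by simp
  then show ?thesis using assms(2) \<open>v \<notin> ?S\<close> by (auto simp: frontier_def visit_def)
qed

lemma frontier_fold_visit:
  assumes "wf_temporal_graph G" "frontier G q s" "u \<in> x_C s" "distinct vs"
    "\<And>v. v \<in> set vs \<Longrightarrow> {u, v} \<in> edges G \<and> v \<notin> x_visited s"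
  shows "frontier G q (fold (visit G) vs s)"
  using assms(2-)
proof (induction vs arbitrary: s)
  case (Cons v vs)
  have "frontier G q (fold (visit G) vs (visit G v s))"
  proof (rule Cons.IH)
    show "frontier G q (visit G v s)"
      using Cons.prems assms(1) by (intro frontier_visit[of G q s u v]) auto
  qed (use Cons.prems in \<open>auto simp: visit_def\<close>)
  then show ?case by simp
qed simp

lemma queue_fold_visit: "set (x_queue s) \<subseteq> set (x_queue (fold (visit G) vs s))"
proof (induction vs arbitrary: s)
  case (Cons v vs)
  have "set (x_queue s) \<subseteq> set (x_queue (visit G v s))" by (auto simp: visit_def)
  also have "\<dots> \<subseteq> set (x_queue (fold (visit G) vs (visit G v s)))" by (rule Cons.IH)
  finally show ?case by simp
qed simp

text \<open>With bound 0 the admission test compares a nonnegative number with 0. This serves the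
  first iteration, where it yields an induced edge at \<open>q\<close>.\<close>

lemma fold_visit_pushes_all:
  assumes "\<And>e. 0 \<le> x_res s e" "\<And>v. 0 \<le> x_tppr s v" "x_beta s = 0"
  shows "set (x_queue (fold (visit G) vs s)) = set (x_queue s) \<union> set vs"
  using assms
proof (induction vs arbitrary: s)
  case (Cons v vs)
  have "x_beta s \<le> total_res G (x_res s) + (\<Sum>w\<in>nbrs G (verts G) v. x_tppr s w)"
    using Cons.prems by (auto simp: total_res_def intro!: add_nonneg_nonneg sum_nonneg)
  then have "set (x_queue (visit G v s)) = insert v (set (x_queue s))"
    by (auto simp: visit_def)
  then show ?case using Cons.IH[of "visit G v s"] Cons.prems by (auto simp: visit_def)
qed simp

lemma mass_bounded_tppr_nonneg:
  assumes "mass_bounded G \<alpha> B s" "0 < \<alpha>" shows "0 \<le> x_tppr s v"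
proof -
  have "x_tppr s v = 0 \<or> \<alpha> / card (tedges G) \<le> x_tppr s v"
    using assms(1) by (simp add: mass_bounded_def)
  moreover have "0 \<le> \<alpha> / card (tedges G)" using assms(2) by simp
  ultimately show ?thesis by linarith
qed

text \<open>
  Every vertex is taken from the queue at most once, so the out-edges of \<open>x_C s\<close> count the
  propagations so far. Each of them raises the total of \<open>tppr\<close> by at most \<open>\<alpha>\<close>.
\<close>

definition expand_invar :: "'v temporal_graph \<Rightarrow> 'v \<Rightarrow> real \<Rightarrow> 'v expand_state \<Rightarrow> bool" where
  "expand_invar G q \<alpha> s \<longleftrightarrow> frontier G q s \<and>
     mass_bounded G \<alpha> (\<alpha> * (\<Sum>u\<in>x_C s. card (out_edges G u))) s"

text \<open>Besides preservation: induced edges on processed and waiting vertices are never lost,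
  and the first iteration creates one. Together these give at least one edge on the final
  set.\<close>

lemma expand_invar_iter:
  assumes wf: "wf_temporal_graph G" and \<alpha>: "0 < \<alpha>" "\<alpha> < 1"
    and s: "expand_invar G q \<alpha> s" and iter: "expand_iter G \<alpha> s s'"
  shows "expand_invar G q \<alpha> s'"
    and "induced_edges G (x_C s \<union> set (x_queue s)) \<subseteq> induced_edges G (x_C s' \<union> set (x_queue s'))"
    and "x_C s = {} \<Longrightarrow> x_queue s = [q] \<Longrightarrow> x_visited s = {q} \<Longrightarrow> x_beta s = 0 \<Longrightarrow> out_edges G q \<noteq> {} \<Longrightarrow>
         induced_edges G (x_C s' \<union> set (x_queue s')) \<noteq> {}"
proof -
  from iter obtain u us es vs s1 s2 where
    q: "x_queue s = u # us" and es: "distinct es" "set es = out_edges G u" and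
    vs: "distinct vs" "set vs = nbrs G (verts G) u - x_visited s" and
    s1: "s1 = fold (propagation G \<alpha>) es (s\<lparr>x_queue := us, x_C := insert u (x_C s)\<rparr>)" and
    s2: "s2 = fold (visit G) vs (update_beta G s1)" and s': "s' = check_stop G s2"
    by (cases rule: expand_iter.cases) blast
  have fr: "frontier G q s" using s by (simp add: expand_invar_def)
  have u: "u \<notin> x_C s" "finite (x_C s)" using fr q by (auto simp: frontier_def)
  have C1: "x_C s1 = insert u (x_C s)" "x_queue s1 = us" "x_visited s1 = x_visited s" "x_beta s1 = x_beta s"
    by (simp_all add: s1 propagation_frame)
  have "mass_bounded G \<alpha> (\<alpha> * (\<Sum>u\<in>x_C s. card (out_edges G u)) + \<alpha> * length es) s1"
    unfolding s1 using es out_edges_subset[of G u] s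
    by (intro mass_bounded_fold_propagation[OF wf \<alpha>]) (auto simp: expand_invar_def mass_bounded_def)
  moreover have "length es = card (out_edges G u)" using es distinct_card by metis
  ultimately have m1: "mass_bounded G \<alpha> (\<alpha> * (\<Sum>u\<in>x_C s1. card (out_edges G u))) s1"
    using u by (simp add: C1 algebra_simps)
  have "frontier G q (update_beta G s1)"
  proof -
    have "insert u (x_C s) \<union> set us = x_C s \<union> set (x_queue s)" using q by auto
    then show ?thesis using fr q by (auto simp: frontier_def update_beta_def C1)
  qed
  then have f2: "frontier G q s2"
    unfolding s2 using vs by (intro frontier_fold_visit[OF wf, where u = u]) (auto simp: update_beta_def C1 nbrs_def)
  have m2: "mass_bounded G \<alpha> (\<alpha> * (\<Sum>u\<in>x_C s2. card (out_edges G u))) s2"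
    using m1 by (simp add: s2 visit_frame update_beta_def mass_bounded_def)
  have fin2: "finite (x_C s2)" using f2 by (simp add: frontier_def)
  \<comment> \<open>The early stop only moves waiting vertices into \<open>x_C\<close>; edge and
    vertex counts of the union are unaffected.\<close>
  have union: "x_C s' \<union> set (x_queue s') = x_C s2 \<union> set (x_queue s2)" by (auto simp: s' check_stop_def)
  \<comment> \<open>The early stop adds vertices that were never propagated, which only weakens the
    bound on the mass.\<close>
  have "(\<Sum>u\<in>x_C s2. card (out_edges G u)) \<le> (\<Sum>u\<in>x_C s'. card (out_edges G u))"
    using fin2 by (intro sum_mono2) (auto simp: s' check_stop_def)
  then have "\<alpha> * (\<Sum>u\<in>x_C s2. card (out_edges G u)) \<le> \<alpha> * (\<Sum>u\<in>x_C s'. card (out_edges G u))"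
    using \<alpha> by (intro mult_left_mono) (auto simp del: of_nat_sum)
  moreover have "x_res s' = x_res s2" "x_tppr s' = x_tppr s2" by (auto simp: s' check_stop_def)
  ultimately have "mass_bounded G \<alpha> (\<alpha> * (\<Sum>u\<in>x_C s'. card (out_edges G u))) s'"
    using m2 unfolding mass_bounded_def by auto
  moreover have "frontier G q s'" using f2 by (auto simp: s' check_stop_def frontier_def)
  ultimately show "expand_invar G q \<alpha> s'" by (simp add: expand_invar_def)
  have "set us \<subseteq> set (x_queue s2)"
    using queue_fold_visit[of "update_beta G s1" G vs] by (simp add: s2 update_beta_def C1)
  moreover have C2: "x_C s2 = insert u (x_C s)" by (simp add: s2 visit_frame update_beta_def C1)
  ultimately show "induced_edges G (x_C s \<union> set (x_queue s)) \<subseteq> induced_edges G (x_C s' \<union> set (x_queue s'))"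
    unfolding union using q by (auto simp: induced_edges_def)
  assume init: "x_C s = {}" "x_queue s = [q]" "x_visited s = {q}" "x_beta s = 0" and "out_edges G q \<noteq> {}"
  then obtain v t where "(q, v, t) \<in> ordered_edges G" by (auto simp: out_edges_def ehead_def)
  from edge_of_ordered[OF this] have qv: "{q, v} \<in> edges G" .
  have uq: "u = q" using init q by simp
  show "induced_edges G (x_C s' \<union> set (x_queue s')) \<noteq> {}"
  \<comment> \<open>A loop at \<open>q\<close> is itself an induced edge. Without one,
    \<open>q\<close> has no neighbour in the singleton \<open>x_C\<close>, the bound stays 0, and
    every neighbour of \<open>q\<close> is pushed.\<close>
  proof (cases "{q} \<in> edges G")
    case True
    then show ?thesis unfolding union using C2 uq by (auto simp: induced_edges_def)
  next
    case False
    then have "v \<noteq> q" using qv by auto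
    have "nbrs G {q} q = {}" using False by (auto simp: nbrs_def)
    then have "x_beta (update_beta G s1) = 0"
      using init uq by (simp add: update_beta_def C1)
    moreover have "0 \<le> x_res s1 e" for e using m1 unfolding mass_bounded_def by blast
    moreover have "0 \<le> x_tppr s1 v" for v by (rule mass_bounded_tppr_nonneg[OF m1 \<alpha>(1)])
    ultimately have "set (x_queue s2) = set us \<union> set vs"
      unfolding s2 by (subst fold_visit_pushes_all) (simp_all add: update_beta_def C1)
    moreover have "v \<in> set vs"
      using qv edges_subset_verts[OF wf qv] vs uq init \<open>v \<noteq> q\<close> by (auto simp: nbrs_def)
    ultimately show ?thesis unfolding union using C2 uq qv by (auto simp: induced_edges_def)
  qed
qed

text \<open>Everything that the analysis of Reducing takes from Expanding. The final state is not
  the initial one, whose queue contains \<open>q\<close>, so at least one iteration took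
  place.\<close>

lemma expanding_output_bounds:
  assumes inp: "reducing_input G q \<alpha> C r tppr"
  shows "finite C" "q \<in> C" "card C \<le> card (induced_edges G C) + 1" "1 \<le> card (induced_edges G C)"
    and "0 \<le> total_res G r"
    and "tppr v = 0 \<or> \<alpha> / card (tedges G) \<le> tppr v"
    and "(\<Sum>v\<in>verts G. tppr v) \<le> 2 * \<alpha> * card (tedges G)"
    and "0 \<le> tppr v" "1 \<le> card (tedges G)"
proof -
  have wf: "wf_temporal_graph G" and ne: "out_edges G q \<noteq> {}" and \<alpha>: "0 < \<alpha>" "\<alpha> < 1"
    using inp by (auto simp: reducing_input_def)
  from inp obtain s where st: "(expand_iter G \<alpha>)\<^sup>*\<^sup>* (expand_init G q) s" and s: "x_queue s = []"
    "C = x_C s" "r = x_res s" "tppr = x_tppr s"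
    by (auto simp: reducing_input_def expanding_output_def)
  have finO: "finite (out_edges G q)"
    using finite_ordered_edges(1)[OF wf] out_edges_subset by (rule finite_subset[rotated])
  have "total_res G (x_res (expand_init G q)) = 1"
    using ne finO out_edges_subset[of G q] finite_ordered_edges(1)[OF wf]
    by (simp add: total_res_def expand_init_def sum.inter_restrict[symmetric] Int_absorb1)
  then have init: "expand_invar G q \<alpha> (expand_init G q)"
    by (auto simp: expand_invar_def frontier_def mass_bounded_def expand_init_def)
  \<comment> \<open>The initial state must be excepted: its only vertex need not carry an
    edge.\<close>
  from st have *: "expand_invar G q \<alpha> s \<and> (s = expand_init G q \<or> induced_edges G (x_C s \<union> set (x_queue s)) \<noteq> {})"
  proof (induction s rule: rtranclp_induct)
    case base
    show ?case using init by simp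
  next
    case (step s s')
    then have "expand_invar G q \<alpha> s" by blast
    note it = expand_invar_iter[OF wf \<alpha> this step(2)]
    show ?case
    proof (cases "s = expand_init G q")
      case True
      then show ?thesis using it(1,3) ne by (simp add: expand_init_def)
    next
      case False
      then show ?thesis using it(1,2) step by blast
    qed
  qed
  then have inv: "frontier G q s" "mass_bounded G \<alpha> (\<alpha> * (\<Sum>u\<in>C. card (out_edges G u))) s"
    by (auto simp: expand_invar_def s)
  show "finite C" "q \<in> C" "card C \<le> card (induced_edges G C) + 1"
    using inv(1) by (auto simp: frontier_def s)
  have "s \<noteq> expand_init G q" using s by (auto simp: expand_init_def)
  with * s have "induced_edges G C \<noteq> {}" by simp
  then show "1 \<le> card (induced_edges G C)"
    using finite_induced_edges[OF wf, of C] by (simp add: Suc_le_eq card_gt_0_iff)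
  show "0 \<le> total_res G r" using inv(2) by (auto simp: mass_bounded_def s total_res_def intro: sum_nonneg)
  show "tppr v = 0 \<or> \<alpha> / card (tedges G) \<le> tppr v" using inv(2) by (simp add: mass_bounded_def s)
  show "0 \<le> tppr v" using mass_bounded_tppr_nonneg[OF inv(2) \<alpha>(1)] by (simp add: s)
  have "(\<Sum>v\<in>verts G. tppr v) \<le> \<alpha> * (\<Sum>u\<in>C. card (out_edges G u))"
    using inv(2) by (simp add: mass_bounded_def s)
  also have "\<dots> \<le> \<alpha> * real (2 * card (tedges G))"
    using sum_card_out_edges[OF wf \<open>finite C\<close>] \<alpha> by (intro mult_left_mono) (simp_all only: of_nat_le_iff)
  finally show "(\<Sum>v\<in>verts G. tppr v) \<le> 2 * \<alpha> * card (tedges G)" by (simp add: mult_ac)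
  have "tedges G \<noteq> {}" using ne by (auto simp: out_edges_def ordered_edges_def)
  then show "1 \<le> card (tedges G)"
    using wf by (simp add: wf_temporal_graph_def Suc_le_eq card_gt_0_iff)
qed


section \<open>The running time of Reducing\<close>

text \<open>Serves as \<open>I\<close> throughout, so it holds at every intermediate state and
  yields the space bound: each container has at most \<open>card C\<close> entries, the queue
  because it is distinct.\<close>

definition supported :: "'v set \<Rightarrow> 'v reduce_state \<Rightarrow> bool" where
  "supported C s \<longleftrightarrow> R s \<subseteq> C \<and> dom (rho s) \<subseteq> C \<and> distinct (queue s) \<and> set (queue s) \<subseteq> C \<and>
     D s \<subseteq> C \<and> comp s \<subseteq> C \<and> cur s \<in> C"

text \<open>Relates the states around \<open>push_if_low\<close>, which may alter
  \<open>flag\<close> and the queue.\<close>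

definition agree :: "'v reduce_state \<Rightarrow> 'v reduce_state \<Rightarrow> bool" where
  "agree s t \<longleftrightarrow> R t = R s \<and> rho t = rho s \<and> D t = D s \<and> temp t = temp s \<and> eps_bar t = eps_bar s"

locale reducing_run =
  fixes G :: "'v temporal_graph" and C :: "'v set" and tppr :: "'v \<Rightarrow> real" and q :: 'v
  assumes finite_C: "finite C" and q_in_C: "q \<in> C" and tppr_nonneg: "0 \<le> tppr v"
begin

abbreviation deg :: "'v \<Rightarrow> nat" where
  "deg u \<equiv> card (nbrs G C u)"

lemma finite_nbrs: "finite (nbrs G C u)"
  using finite_C nbrs_subset by (rule finite_subset[rotated])

lemma finite_sub: "X \<subseteq> C \<Longrightarrow> finite X"
  using finite_C by (rule finite_subset[rotated])

lemma length_queue_le: "supported C s \<Longrightarrow> length (queue s) \<le> card C"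
  unfolding supported_def by (metis card_mono distinct_card finite_C)

lemma card_D_le: "supported C s \<Longrightarrow> card (D s) \<le> card C"
  and card_R_le: "supported C s \<Longrightarrow> card (R s) \<le> card C"
  unfolding supported_def by (auto intro: card_mono finite_C)

text \<open>Each entry costs the loop test, the assignment and the discarded \<open>Skip\<close>;
  one last test ends the loop.\<close>

lemma wp_clear_queue:
  assumes "supported C s"
  shows "wp (supported C) (\<lambda>_ t. t = s\<lparr>queue := []\<rparr>) (3 * length (queue s) + 1) clear_queue s"
  unfolding clear_queue_def
proof (rule wp_While[where Inv = "\<lambda>T t. \<exists>xs. t = s\<lparr>queue := xs\<rparr> \<and> 3 * length xs + 1 \<le> T"])
  fix T t
  assume t: "supported C t" "\<exists>xs. t = s\<lparr>queue := xs\<rparr> \<and> 3 * length xs + 1 \<le> T" "queue t \<noteq> []"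
  then obtain x xs where x: "t = s\<lparr>queue := x # xs\<rparr>" "3 * length xs + 4 \<le> T"
    by (auto simp: neq_Nil_conv)
  then show "wp (supported C) (\<lambda>T' s'. 1 \<le> T' \<and> (\<exists>xs. s' = s\<lparr>queue := xs\<rparr> \<and> 3 * length xs + 1 \<le> T' - 1))
        (T - 1) (Basic (\<lambda>s. s\<lparr>queue := tl (queue s)\<rparr>)) t"
    using t(1) by (intro wp_Basic) (auto simp: supported_def)
qed (use assms in \<open>auto intro!: exI[of _ "queue s"]\<close>)

lemma wp_push:
  assumes "supported C s" "v \<in> C"
  shows "wp (supported C)
     (\<lambda>_ t. t = s\<lparr>queue := if v \<in> set (queue s) then queue s else queue s @ [v]\<rparr>) 2 (push v) s"
  unfolding push_def using assms
  by (intro wp_Cond wp_Skip wp_Basic) (auto simp: supported_def)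

text \<open>Three credits per queue entry are a potential that pays for clearing the queue when
  \<open>q\<close> is reached. The constant 11 is 8 for the other steps and 3 for a new entry. A
  push of \<open>q\<close> is followed at once by clearing, so \<open>q\<close> never stays in the
  queue.\<close>

lemma wp_push_if_low:
  assumes s: "supported C s" and v: "v \<in> C"
  shows "wp (supported C)
     (\<lambda>p t. agree s t \<and> 3 * length (queue t) \<le> p \<and>
        set (queue t) \<subseteq> insert v (set (queue s)) \<and> (q \<notin> set (queue s) \<longrightarrow> q \<notin> set (queue t)) \<and>
        (flag t \<longrightarrow> flag s \<and> (v = q \<longrightarrow> \<not> eps_bar s * the (rho s q) \<le> temp s)))
     (3 * length (queue s) + 11) (push_if_low q v) s"
    (is "wp _ ?Q _ _ _")
  unfolding push_if_low_def
proof (rule wp_Cond)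
  let ?qu = "if v \<in> set (queue s) then queue s else queue s @ [v]"
  let ?t = "s\<lparr>queue := ?qu\<rparr>"
  have len: "length ?qu \<le> length (queue s) + 1" by simp
  fix T assume T: "3 * length (queue s) + 11 = Suc T"
  show "wp (supported C) ?Q T
     (push v ;; Cond (\<lambda>_. v = q) (Basic (\<lambda>s. s\<lparr>flag := False\<rparr>) ;; clear_queue) Skip) s"
  proof (rule wp_Seq_call[OF wp_push[OF s v]], use T in simp, hypsubst, rule wp_Cond)
    fix p :: nat and T1 T2
    assume t: "supported C ?t" and T1: "T1 + 2 + 1 = T + p" "T1 = Suc T2"
    then have sup: "supported C (?t\<lparr>flag := False\<rparr>)" by (simp add: supported_def)
    show "wp (supported C) ?Q T2 (Basic (\<lambda>s. s\<lparr>flag := False\<rparr>) ;; clear_queue) ?t"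
      by (rule wp_Seq_Basic, rule t, rule sup, use T T1 in simp, rule wp_call[OF wp_clear_queue[OF sup]])
         (use T T1 len in \<open>auto simp: agree_def\<close>)
    show "wp (supported C) ?Q T2 Skip ?t" if "v \<noteq> q"
      using t len that T T1 by (intro wp_Skip) (auto simp: agree_def)
  qed (use T in auto)
  show "wp (supported C) ?Q T Skip s"
    if "\<not> eps_bar s * the (rho s v) \<le> temp s"
    using s that T by (intro wp_Skip) (auto simp: agree_def)
qed (use s in auto)

text \<open>\<open>For\<close> evaluates \<open>D\<close> once on entry, so deleting from it during
  the loop is harmless.\<close>

lemma wp_clear_D:
  assumes s: "supported C s"
  shows "wp (supported C) (\<lambda>_ t. t = s\<lparr>D := {}\<rparr>) (3 * card (D s) + 2)
     (For D (\<lambda>u. Basic (\<lambda>s. s\<lparr>D := D s - {u}\<rparr>))) s"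
proof (rule wp_For[where J = "\<lambda>X t. t = s\<lparr>D := D s - X\<rparr>" and \<phi> = "\<lambda>_. 0" and b = "\<lambda>_. 1"])
  show "finite (D s)" using s by (simp add: supported_def finite_sub)
  fix X x t assume t: "supported C t" "t = s\<lparr>D := D s - X\<rparr>"
  have "D s - X - {x} = D s - insert x X" by blast
  then show "wp (supported C) (\<lambda>p t'. 0 \<le> p \<and> t' = s\<lparr>D := D s - insert x X\<rparr>) (0 + 1)
      (Basic (\<lambda>s. s\<lparr>D := D s - {x}\<rparr>)) t"
    using t by (intro wp_Basic) (auto simp: supported_def)
qed (use s in simp_all)

lemma wp_remove_D_from_R:
  assumes s: "supported C s"
  shows "wp (supported C) (\<lambda>_ t. t = s\<lparr>R := R s - D s\<rparr>) (3 * card (D s) + 2)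
     (For D (\<lambda>u. Basic (\<lambda>s. s\<lparr>R := R s - {u}\<rparr>))) s"
proof (rule wp_For[where J = "\<lambda>X t. t = s\<lparr>R := R s - X\<rparr>" and \<phi> = "\<lambda>_. 0" and b = "\<lambda>_. 1"])
  show "finite (D s)" using s by (simp add: supported_def finite_sub)
  fix X x t assume t: "supported C t" "t = s\<lparr>R := R s - X\<rparr>"
  have "R s - X - {x} = R s - insert x X" by blast
  then show "wp (supported C) (\<lambda>p t'. 0 \<le> p \<and> t' = s\<lparr>R := R s - insert x X\<rparr>) (0 + 1)
      (Basic (\<lambda>s. s\<lparr>R := R s - {x}\<rparr>)) t"
    using t by (intro wp_Basic) (auto simp: supported_def)
qed (use s in simp_all)

text \<open>Credits that pay for taking \<open>u\<close> from the queue and scanning its adjacency list.\<close>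

definition visit_cost :: "'v \<Rightarrow> nat" where
  "visit_cost u = 8 + 16 * deg u"

lemma sum_visit_cost: "(\<Sum>u\<in>C. visit_cost u) = 8 * card C + 16 * (\<Sum>u\<in>C. deg u)"
  by (simp add: visit_cost_def sum.distrib sum_distrib_left)

section \<open>One round of peeling\<close>

definition scan :: "('v, 'v reduce_state) com" where
  "scan = For R (push_if_low q)"

definition peel :: "('v, 'v reduce_state) com" where
  "peel = While (\<lambda>s. queue s \<noteq> [])
          (pop ;;
           Basic (\<lambda>s. s\<lparr>D := insert (cur s) (D s)\<rparr>) ;;
           For (\<lambda>s. nbrs G C (cur s)) (\<lambda>v.
             Cond (\<lambda>s. v \<in> R s \<and> v \<notin> D s)
               (Basic (\<lambda>s. s\<lparr>rho := (rho s)(v \<mapsto> the (rho s v) - tppr (cur s))\<rparr>) ;;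
                push_if_low q v)
               Skip))"

text \<open>\<rho> is a fixed upper bound for the value at \<open>q\<close>, which peeling can only
  lower; \<tau> and \<epsilon> are constant during a round.\<close>

definition round_invar :: "real \<Rightarrow> real \<Rightarrow> real \<Rightarrow> 'v reduce_state \<Rightarrow> bool" where
  "round_invar \<tau> \<epsilon> \<rho> s \<longleftrightarrow> temp s = \<tau> \<and> eps_bar s = \<epsilon> \<and> the (rho s q) \<le> \<rho> \<and> q \<in> R s"

text \<open>The scan passes \<open>q\<close>, which lies in \<open>R\<close>. If \<epsilon> times
  \<rho> is at most \<tau>, the test at \<open>q\<close> succeeds and lowers \<open>flag\<close>;
  \<open>?J\<close> remembers the outcome once \<open>q\<close> has been passed.\<close>

lemma wp_scan:
  assumes s: "supported C s" "round_invar \<tau> \<epsilon> \<rho> s" "queue s = []" "0 \<le> \<epsilon>"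
  shows "wp (supported C)
     (\<lambda>p t. agree s t \<and> 3 * length (queue t) \<le> p \<and> q \<notin> set (queue t) \<and> (flag t \<longrightarrow> \<not> \<epsilon> * \<rho> \<le> \<tau>))
     (13 * card C + 2) scan s"
proof -
  let ?J = "\<lambda>X t. agree s t \<and> q \<notin> set (queue t) \<and> (flag t \<longrightarrow> q \<in> X \<longrightarrow> \<not> \<epsilon> * \<rho> \<le> \<tau>)"
  have low: "\<epsilon> * the (rho s q) \<le> \<tau>" if "\<epsilon> * \<rho> \<le> \<tau>"
  proof -
    have "\<epsilon> * the (rho s q) \<le> \<epsilon> * \<rho>"
      using s(2,4) by (intro mult_left_mono) (simp_all add: round_invar_def)
    then show ?thesis using that by (rule order_trans)
  qed
  have s': "temp s = \<tau>" "eps_bar s = \<epsilon>" "q \<in> R s" using s(2) by (simp_all add: round_invar_def)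
  show ?thesis
    unfolding scan_def
  proof (rule wp_For[where \<phi> = "\<lambda>t. 3 * length (queue t)" and b = "\<lambda>_. 11" and J = ?J])
    show "supported C s" by (rule s)
    show "finite (R s)" using s by (simp add: supported_def finite_sub)
    show "?J {} s" using s(3) by (simp add: agree_def)
    show "3 * length (queue s) + (\<Sum>x\<in>R s. 11 + 2) + 2 \<le> 13 * card C + 2"
      using card_R_le[OF s(1)] s(3) by simp
  next
    fix X x t
    assume t: "supported C t" "?J X t" and x: "x \<in> R s"
    have "x \<in> C" using x s(1) by (auto simp: supported_def)
    show "wp (supported C) (\<lambda>p t'. 3 * length (queue t') \<le> p \<and> ?J (insert x X) t')
      (3 * length (queue t) + 11) (push_if_low q x) t"
      by (rule wp_call[OF wp_push_if_low[OF t(1) \<open>x \<in> C\<close>]]) (use t(2) s' low in \<open>auto simp: agree_def\<close>)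
  qed (use s' in auto)
qed

text \<open>
  A vertex of \<open>D\<close> is never pushed again, so the credits of the vertices outside \<open>D\<close> pay for all
  pops; three more credits per queue entry pay for clearing it.
\<close>

definition peel_invar :: "bool \<Rightarrow> real \<Rightarrow> real \<Rightarrow> real \<Rightarrow> 'v reduce_state \<Rightarrow> bool" where
  "peel_invar b \<tau> \<epsilon> \<rho> s \<longleftrightarrow> round_invar \<tau> \<epsilon> \<rho> s \<and> (flag s \<longrightarrow> b) \<and>
     set (queue s) \<inter> D s = {} \<and> q \<notin> set (queue s) \<and> q \<notin> D s"

text \<open>Subtracting a nonnegative \<open>tppr\<close> keeps \<rho> an upper bound at
  \<open>q\<close>, and the guard \<open>v \<notin> D s\<close> keeps the queue disjoint from
  \<open>D\<close>.\<close>

lemma wp_relax_neighbour: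
  assumes s: "supported C s" "peel_invar b \<tau> \<epsilon> \<rho> s" "D s = D0" and v: "v \<in> C"
  shows "wp (supported C) (\<lambda>p t. 3 * length (queue t) \<le> p \<and> peel_invar b \<tau> \<epsilon> \<rho> t \<and> D t = D0)
     (3 * length (queue s) + 14)
     (Cond (\<lambda>s. v \<in> R s \<and> v \<notin> D s)
        (Basic (\<lambda>s. s\<lparr>rho := (rho s)(v \<mapsto> the (rho s v) - tppr (cur s))\<rparr>) ;; push_if_low q v)
        Skip) s"
proof (rule wp_Cond)
  show "supported C s" by (rule s)
  fix T assume T: "3 * length (queue s) + 14 = Suc T" and vs: "v \<in> R s \<and> v \<notin> D s"
  define t where "t = s\<lparr>rho := (rho s)(v \<mapsto> the (rho s v) - tppr (cur s))\<rparr>"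
  have t: "supported C t" using s(1) v by (auto simp: supported_def t_def)
  have "the (rho t q) \<le> the (rho s q)" using tppr_nonneg[of "cur s"] by (simp add: t_def)
  then have inv: "peel_invar b \<tau> \<epsilon> \<rho> t"
    using s(2) by (simp add: peel_invar_def round_invar_def t_def)
  have sel: "queue t = queue s" "D t = D0" "v \<notin> D t" using s(3) vs by (simp_all add: t_def)
  show "wp (supported C) (\<lambda>p t. 3 * length (queue t) \<le> p \<and> peel_invar b \<tau> \<epsilon> \<rho> t \<and> D t = D0) T
     (Basic (\<lambda>s. s\<lparr>rho := (rho s)(v \<mapsto> the (rho s v) - tppr (cur s))\<rparr>) ;; push_if_low q v) s"
  proof (rule wp_Seq_Basic, goal_cases)
    case (4 T')
    show ?case
      unfolding t_def[symmetric]
    proof (rule wp_call[OF wp_push_if_low[OF t v]])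
      show "3 * length (queue t) + 11 \<le> T'" using 4 T sel by simp
      fix p t'
      assume *: "agree t t' \<and> 3 * length (queue t') \<le> p \<and>
        set (queue t') \<subseteq> insert v (set (queue t)) \<and> (q \<notin> set (queue t) \<longrightarrow> q \<notin> set (queue t')) \<and>
        (flag t' \<longrightarrow> flag t \<and> (v = q \<longrightarrow> \<not> eps_bar t * the (rho t q) \<le> temp t))"
      then have "peel_invar b \<tau> \<epsilon> \<rho> t'"
        using inv sel(3) by (auto simp: peel_invar_def round_invar_def agree_def)
      then show "3 * length (queue t') \<le> T' - (3 * length (queue t) + 11) + p \<and>
          peel_invar b \<tau> \<epsilon> \<rho> t' \<and> D t' = D0"
        using * sel(2) by (simp add: agree_def)
    qed
  qed (use s t T t_def in simp_all)
next
  fix T assume "3 * length (queue s) + 14 = Suc T"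
  then show "wp (supported C) (\<lambda>p t. 3 * length (queue t) \<le> p \<and> peel_invar b \<tau> \<epsilon> \<rho> t \<and> D t = D0) T Skip s"
    using s by (intro wp_Skip) simp_all
qed simp

lemma wp_peel:
  assumes s: "supported C s" "peel_invar b \<tau> \<epsilon> \<rho> s" "D s = {}"
  shows "wp (supported C) (\<lambda>p t. peel_invar b \<tau> \<epsilon> \<rho> t)
     (3 * length (queue s) + (\<Sum>u\<in>C. visit_cost u) + 1) peel s"
  unfolding peel_def
proof (rule wp_While[where Inv = "\<lambda>T t. peel_invar b \<tau> \<epsilon> \<rho> t \<and>
      3 * length (queue t) + (\<Sum>u\<in>C - D t. visit_cost u) + 1 \<le> T"])
  fix T t
  assume t: "supported C t" and inv: "peel_invar b \<tau> \<epsilon> \<rho> t \<and>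
      3 * length (queue t) + (\<Sum>u\<in>C - D t. visit_cost u) + 1 \<le> T" and ne: "queue t \<noteq> []"
  obtain u us where us: "queue t = u # us" using ne by (cases "queue t") auto
  \<comment> \<open>\<open>q\<close> is never popped, so it stays outside \<open>D\<close> and
    survives the later update of \<open>R\<close>.\<close>
  have u: "u \<in> C" "u \<notin> D t" "u \<noteq> q" using t inv us by (auto simp: supported_def peel_invar_def)
  \<comment> \<open>The popped vertex enters \<open>D\<close>, so its \<open>visit_cost\<close>
    leaves the reserve and is released for this iteration.\<close>
  have split: "(\<Sum>u\<in>C - D t. visit_cost u) = visit_cost u + (\<Sum>u\<in>C - insert u (D t). visit_cost u)"
    using u finite_C sum.remove[of "C - D t" u visit_cost] by (simp add: Diff_insert[symmetric])
  let ?t1 = "t\<lparr>cur := u, queue := us\<rparr>" and ?t2 = "t\<lparr>cur := u, queue := us, D := insert u (D t)\<rparr>"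
  let ?Q = "\<lambda>T' s'. 1 \<le> T' \<and> peel_invar b \<tau> \<epsilon> \<rho> s' \<and>
      3 * length (queue s') + (\<Sum>u\<in>C - D s'. visit_cost u) + 1 \<le> T' - 1"
  have t1: "supported C ?t1" and t2: "supported C ?t2" using t us u by (auto simp: supported_def)
  have inv2: "peel_invar b \<tau> \<epsilon> \<rho> ?t2"
    using inv us u t by (auto simp: peel_invar_def round_invar_def supported_def)
  have pop: "(\<lambda>s. s\<lparr>cur := hd (queue s), queue := tl (queue s)\<rparr>) t = ?t1" using us by simp
  \<comment> \<open>12 collects the 3 credits stored with the popped entry, the 8 fixed ones of
    \<open>visit_cost\<close> and the 1 kept for the loop test.\<close>
  have T: "3 * length us + 12 + 16 * deg u + (\<Sum>u\<in>C - insert u (D t). visit_cost u) \<le> T"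
    using inv us split by (simp add: visit_cost_def)
  have "wp (supported C) ?Q T'
     (For (\<lambda>s. nbrs G C (cur s)) (\<lambda>v.
             Cond (\<lambda>s. v \<in> R s \<and> v \<notin> D s)
               (Basic (\<lambda>s. s\<lparr>rho := (rho s)(v \<mapsto> the (rho s v) - tppr (cur s))\<rparr>) ;;
                push_if_low q v)
               Skip)) ?t2" if T': "T' + 5 = T" for T'
  proof (rule wp_For[where \<phi> = "\<lambda>t. 3 * length (queue t)" and b = "\<lambda>_. 14" and
        J = "\<lambda>_ s'. peel_invar b \<tau> \<epsilon> \<rho> s' \<and> D s' = insert u (D t)"])
    show "3 * length (queue ?t2) + (\<Sum>x\<in>nbrs G C (cur ?t2). 14 + 2) + 2 \<le> T'"
      using T T' by simp
    fix p t' assume "peel_invar b \<tau> \<epsilon> \<rho> t' \<and> D t' = insert u (D t)"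
      "T' - (3 * length (queue ?t2) + (\<Sum>x\<in>nbrs G C (cur ?t2). 14 + 2) + 2) + 3 * length (queue t') \<le> p"
    then show "?Q p t'" using T T' by auto
  qed (use t2 inv2 finite_nbrs nbrs_subset[of G C u] in \<open>auto intro!: wp_relax_neighbour\<close>)
  then show "wp (supported C) ?Q (T - 1)
     (pop ;;
           Basic (\<lambda>s. s\<lparr>D := insert (cur s) (D s)\<rparr>) ;;
           For (\<lambda>s. nbrs G C (cur s)) (\<lambda>v.
             Cond (\<lambda>s. v \<in> R s \<and> v \<notin> D s)
               (Basic (\<lambda>s. s\<lparr>rho := (rho s)(v \<mapsto> the (rho s v) - tppr (cur s))\<rparr>) ;;
                push_if_low q v)
               Skip)) t"
    unfolding pop_def using t t1 t2 us T
    by (intro wp_Seq_Basic) auto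
qed (use s in auto)

text \<open>Per vertex: 3 for clearing the queue, 3 for emptying \<open>D\<close>, 13 for the scan,
  8 for peeling, 3 for updating \<open>R\<close>.\<close>

definition round_cost :: nat where
  "round_cost = 30 * card C + 16 * (\<Sum>u\<in>C. deg u) + 20"

definition reduce_round :: "('v, 'v reduce_state) com" where
  "reduce_round = (clear_queue ;; For D (\<lambda>u. Basic (\<lambda>s. s\<lparr>D := D s - {u}\<rparr>)) ;; scan ;; peel ;;
        Cond flag
          (Basic (\<lambda>s. s\<lparr>eps := Some (eps_bar s)\<rparr>) ;;
           For D (\<lambda>u. Basic (\<lambda>s. s\<lparr>R := R s - {u}\<rparr>)) ;;
           Basic (\<lambda>s. s\<lparr>eps_bar := eps_bar s / 2\<rparr>))
          Skip)"

lemma reduce_loop_eq: "reduce_loop G C tppr q = While flag reduce_round"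
  by (simp add: reduce_loop_def reduce_round_def scan_def peel_def)

text \<open>A round that leaves \<open>flag\<close> set has tested \<open>q\<close> in vain, so
  \<epsilon> times \<rho> exceeds \<tau>; and \<open>q\<close> is not in \<open>D\<close>, so it
  remains in \<open>R\<close>.\<close>

lemma wp_reduce_round:
  assumes s: "supported C s" "round_invar \<tau> \<epsilon> \<rho> s" "0 \<le> \<epsilon>"
  shows "wp (supported C) (\<lambda>p t. flag t \<longrightarrow> round_invar \<tau> (\<epsilon> / 2) \<rho> t \<and> \<not> \<epsilon> * \<rho> \<le> \<tau>)
     round_cost reduce_round s" (is "wp _ ?Q _ _ _")
proof -
  define s1 where "s1 = s\<lparr>queue := []\<rparr>"
  define s2 where "s2 = s1\<lparr>D := {}\<rparr>"
  have s1: "supported C s1" and s2: "supported C s2" "round_invar \<tau> \<epsilon> \<rho> s2" "queue s2 = []" "D s2 = {}"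
    using s by (auto simp: s1_def s2_def supported_def round_invar_def)
  note bounds = length_queue_le[OF s(1)] card_D_le[OF s1] sum_visit_cost
  \<comment> \<open>The parameter \<open>b\<close> of \<open>peel_invar\<close> is the verdict of
    the scan. Peeling can only lower \<open>flag\<close>, so the verdict carries over to the end of
    the round.\<close>
  have last: "wp (supported C) ?Q T (Cond flag
          (Basic (\<lambda>s. s\<lparr>eps := Some (eps_bar s)\<rparr>) ;;
           For D (\<lambda>u. Basic (\<lambda>s. s\<lparr>R := R s - {u}\<rparr>)) ;;
           Basic (\<lambda>s. s\<lparr>eps_bar := eps_bar s / 2\<rparr>))
          Skip) t"
    if t: "supported C t" "peel_invar (\<not> \<epsilon> * \<rho> \<le> \<tau>) \<tau> \<epsilon> \<rho> t" and T: "3 * card C + 8 \<le> T" for T t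
  proof (rule wp_Cond, rule t(1))
    fix T' assume T': "T = Suc T'" and fl: "flag t"
    let ?t1 = "t\<lparr>eps := Some (eps_bar t)\<rparr>"
    have t1: "supported C ?t1" using t(1) by (simp add: supported_def)
    show "wp (supported C) ?Q T' (Basic (\<lambda>s. s\<lparr>eps := Some (eps_bar s)\<rparr>) ;;
           For D (\<lambda>u. Basic (\<lambda>s. s\<lparr>R := R s - {u}\<rparr>)) ;;
           Basic (\<lambda>s. s\<lparr>eps_bar := eps_bar s / 2\<rparr>)) t"
    proof (rule wp_Seq_Basic, rule t(1), rule t1, use T T' in simp,
        rule wp_Seq_call[OF wp_remove_D_from_R[OF t1]])
      fix T1 assume T1: "T1 + 2 = T'"
      then show "3 * card (D ?t1) + 2 + 1 \<le> T1" using T T' card_D_le[OF t(1)] by simp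
      fix p u T2 assume u: "supported C u" "u = ?t1\<lparr>R := R ?t1 - D ?t1\<rparr>"
        and T2: "T2 + (3 * card (D ?t1) + 2) + 1 = T1 + p"
      show "wp (supported C) ?Q T2 (Basic (\<lambda>s. s\<lparr>eps_bar := eps_bar s / 2\<rparr>)) u"
        using u t(2) fl T T' T1 T2 card_D_le[OF t(1)]
        by (intro wp_Basic) (auto simp: supported_def peel_invar_def round_invar_def)
    qed
  qed (use t T in \<open>auto intro!: wp_Skip\<close>)
  show ?thesis
    unfolding reduce_round_def
  proof (rule wp_Seq_call[OF wp_clear_queue[OF s(1)]])
    show "3 * length (queue s) + 1 + 1 \<le> round_cost" using bounds by (simp add: round_cost_def)
    fix p t T1 assume "t = s\<lparr>queue := []\<rparr>" and T1: "T1 + (3 * length (queue s) + 1) + 1 = round_cost + p"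
    then have t: "t = s1" by (simp add: s1_def)
    show "wp (supported C) ?Q T1 (For D (\<lambda>u. Basic (\<lambda>s. s\<lparr>D := D s - {u}\<rparr>)) ;; scan ;; peel ;;
        Cond flag
          (Basic (\<lambda>s. s\<lparr>eps := Some (eps_bar s)\<rparr>) ;;
           For D (\<lambda>u. Basic (\<lambda>s. s\<lparr>R := R s - {u}\<rparr>)) ;;
           Basic (\<lambda>s. s\<lparr>eps_bar := eps_bar s / 2\<rparr>))
          Skip) t"
      unfolding t
    proof (rule wp_Seq_call[OF wp_clear_D[OF s1]])
      show "3 * card (D s1) + 2 + 1 \<le> T1" using bounds T1 by (simp add: round_cost_def)
      fix p t T2 assume "t = s1\<lparr>D := {}\<rparr>" and T2: "T2 + (3 * card (D s1) + 2) + 1 = T1 + p"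
      then have t: "t = s2" by (simp add: s2_def)
      show "wp (supported C) ?Q T2 (scan ;; peel ;;
          Cond flag
            (Basic (\<lambda>s. s\<lparr>eps := Some (eps_bar s)\<rparr>) ;;
             For D (\<lambda>u. Basic (\<lambda>s. s\<lparr>R := R s - {u}\<rparr>)) ;;
             Basic (\<lambda>s. s\<lparr>eps_bar := eps_bar s / 2\<rparr>))
            Skip) t"
        unfolding t
      proof (rule wp_Seq_call[OF wp_scan[OF s2(1-3) s(3)]])
        show "13 * card C + 2 + 1 \<le> T2" using bounds T1 T2 by (simp add: round_cost_def)
        fix p3 t T3 assume t: "supported C t" and "agree s2 t \<and>
            3 * length (queue t) \<le> p3 \<and> q \<notin> set (queue t) \<and> (flag t \<longrightarrow> \<not> \<epsilon> * \<rho> \<le> \<tau>)"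
          and T3: "T3 + (13 * card C + 2) + 1 = T2 + p3"
        then have t': "peel_invar (\<not> \<epsilon> * \<rho> \<le> \<tau>) \<tau> \<epsilon> \<rho> t" "D t = {}" "3 * length (queue t) \<le> p3"
          using s2 by (auto simp: peel_invar_def round_invar_def agree_def)
        have T3': "3 * length (queue t) + (\<Sum>u\<in>C. visit_cost u) + 2 + 3 * card C + 8 \<le> T3"
          using bounds T1 T2 T3 t'(3) by (simp add: round_cost_def)
        show "wp (supported C) ?Q T3 (peel ;;
            Cond flag
              (Basic (\<lambda>s. s\<lparr>eps := Some (eps_bar s)\<rparr>) ;;
               For D (\<lambda>u. Basic (\<lambda>s. s\<lparr>R := R s - {u}\<rparr>)) ;;
               Basic (\<lambda>s. s\<lparr>eps_bar := eps_bar s / 2\<rparr>))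
              Skip) t"
          by (rule wp_Seq_call[OF wp_peel[OF t t'(1,2)]]) (use T3' in \<open>auto intro!: last\<close>)
      qed
    qed
  qed
qed

text \<open>Round \<open>i\<close> works with \<open>\<epsilon> / 2 ^ i\<close>, and the hypothesis
  on \<open>N\<close> forbids \<open>flag\<close> to survive round \<open>N\<close>, so there are at
  most \<open>N + 1\<close> rounds. The 2 extra credits per round pay for the loop test and the
  discarded \<open>Skip\<close>.\<close>

lemma wp_reduce_loop:
  assumes s: "supported C s" "round_invar \<tau> \<epsilon> \<rho> s" and \<epsilon>: "0 \<le> \<epsilon>" "\<epsilon> / 2 ^ N * \<rho> \<le> \<tau>"
  shows "wp (supported C) (\<lambda>_ _. True) ((N + 1) * (round_cost + 2) + 1) (reduce_loop G C tppr q) s"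
  unfolding reduce_loop_eq
proof (rule wp_While[where Inv = "\<lambda>T t. 1 \<le> T \<and> (flag t \<longrightarrow>
      (\<exists>i\<le>N. round_invar \<tau> (\<epsilon> / 2 ^ i) \<rho> t \<and> (N + 1 - i) * (round_cost + 2) + 1 \<le> T))"])
  fix T t assume t: "supported C t" and inv: "1 \<le> T \<and> (flag t \<longrightarrow>
      (\<exists>i\<le>N. round_invar \<tau> (\<epsilon> / 2 ^ i) \<rho> t \<and> (N + 1 - i) * (round_cost + 2) + 1 \<le> T))" and "flag t"
  then obtain i where i: "i \<le> N" "round_invar \<tau> (\<epsilon> / 2 ^ i) \<rho> t"
    "(N + 1 - i) * (round_cost + 2) + 1 \<le> T" by blast
  have T: "(N - i) * (round_cost + 2) + round_cost + 3 \<le> T"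
    using i(1,3) by (simp add: Suc_diff_le)
  show "wp (supported C) (\<lambda>T' s'. 1 \<le> T' \<and> 1 \<le> T' - 1 \<and> (flag s' \<longrightarrow>
      (\<exists>i\<le>N. round_invar \<tau> (\<epsilon> / 2 ^ i) \<rho> s' \<and> (N + 1 - i) * (round_cost + 2) + 1 \<le> T' - 1)))
      (T - 1) reduce_round t"
  proof (rule wp_call[OF wp_reduce_round[OF t i(2)]])
    fix p s' assume s': "flag s' \<longrightarrow> round_invar \<tau> (\<epsilon> / 2 ^ i / 2) \<rho> s' \<and> \<not> \<epsilon> / 2 ^ i * \<rho> \<le> \<tau>"
    let ?T = "T - 1 - round_cost + p"
    have "\<exists>j\<le>N. round_invar \<tau> (\<epsilon> / 2 ^ j) \<rho> s' \<and> (N + 1 - j) * (round_cost + 2) + 1 \<le> ?T - 1"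
      if "flag s'"
    proof -
      have "i \<noteq> N" using s' that \<epsilon>(2) by auto
      then show ?thesis using i(1) s' that T
        by (intro exI[of _ "Suc i"]) (auto simp: field_simps)
    qed
    then show "1 \<le> ?T \<and> 1 \<le> ?T - 1 \<and> (flag s' \<longrightarrow>
      (\<exists>i\<le>N. round_invar \<tau> (\<epsilon> / 2 ^ i) \<rho> s' \<and> (N + 1 - i) * (round_cost + 2) + 1 \<le> ?T - 1))"
      using T by auto
  qed (use T \<epsilon> in auto)
qed (use s in \<open>auto intro!: exI[of _ 0]\<close>)

section \<open>Component search\<close>

lemma wp_reduce_component:
  assumes s: "supported C s"
  shows "wp (supported C) (\<lambda>_ _. True) round_cost (reduce_component G C q) s"
proof -
  let ?search = "While (\<lambda>s. queue s \<noteq> [])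
       (pop ;;
        For (\<lambda>s. nbrs G C (cur s)) (\<lambda>v.
          Cond (\<lambda>s. v \<in> R s \<and> v \<notin> comp s)
            (Basic (\<lambda>s. s\<lparr>comp := insert v (comp s)\<rparr>) ;; push v)
            Skip))"
  \<comment> \<open>The reserve holds the cost of every vertex that is waiting or undiscovered.
    Discovery moves a vertex from one group to the other and leaves the reserve unchanged; only a
    pop releases credits.\<close>
  define \<Phi> where "\<Phi> t = (\<Sum>u\<in>set (queue t) \<union> (C - comp t). visit_cost u)" for t :: "'v reduce_state"
  have relax: "wp (supported C) (\<lambda>p t'. \<Phi> t' \<le> p \<and> set (queue t') \<subseteq> comp t') (\<Phi> t + 5)
      (Cond (\<lambda>s. v \<in> R s \<and> v \<notin> comp s) (Basic (\<lambda>s. s\<lparr>comp := insert v (comp s)\<rparr>) ;; push v) Skip) t"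
    if t: "supported C t" "set (queue t) \<subseteq> comp t" and v: "v \<in> C" for v t
  proof (rule wp_Cond, rule t(1))
    fix T assume T: "\<Phi> t + 5 = Suc T" and vt: "v \<in> R t \<and> v \<notin> comp t"
    let ?t1 = "t\<lparr>comp := insert v (comp t)\<rparr>" and ?t2 = "t\<lparr>comp := insert v (comp t), queue := queue t @ [v]\<rparr>"
    have t1: "supported C ?t1" using t v by (simp add: supported_def)
    have "set (queue ?t2) \<union> (C - comp ?t2) = set (queue t) \<union> (C - comp t)" using vt v by auto
    then have "\<Phi> ?t2 = \<Phi> t" unfolding \<Phi>_def by (rule arg_cong)
    moreover have "v \<notin> set (queue t)" using vt t(2) by auto
    ultimately show "wp (supported C) (\<lambda>p t'. \<Phi> t' \<le> p \<and> set (queue t') \<subseteq> comp t') T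
       (Basic (\<lambda>s. s\<lparr>comp := insert v (comp s)\<rparr>) ;; push v) t"
      by (intro wp_Seq_Basic t(1) t1 wp_call[OF wp_push[OF t1 v]]) (use t(2) T in auto)
  qed (use t in \<open>auto intro!: wp_Skip\<close>)
  have search: "wp (supported C) (\<lambda>_ _. True) T ?search t"
    if "supported C t" "set (queue t) \<subseteq> comp t" "\<Phi> t + 1 \<le> T" for T t
  proof (rule wp_While[where Inv = "\<lambda>T t. set (queue t) \<subseteq> comp t \<and> \<Phi> t + 1 \<le> T"])
    fix T t assume t: "supported C t" and inv: "set (queue t) \<subseteq> comp t \<and> \<Phi> t + 1 \<le> T" and ne: "queue t \<noteq> []"
    obtain u us where us: "queue t = u # us" using ne by (cases "queue t") auto
    have u: "u \<in> C" "u \<in> comp t" "u \<notin> set us" using t inv us by (auto simp: supported_def)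
    let ?t1 = "t\<lparr>cur := u, queue := us\<rparr>"
    let ?Q = "\<lambda>T' s'. 1 \<le> T' \<and> set (queue s') \<subseteq> comp s' \<and> \<Phi> s' + 1 \<le> T' - 1"
    have t1: "supported C ?t1" using t us u by (auto simp: supported_def)
    have split: "\<Phi> t = visit_cost u + \<Phi> ?t1"
    proof -
      have "set (queue t) \<union> (C - comp t) = insert u (set us \<union> (C - comp t))" using us by auto
      then show ?thesis using u finite_C by (simp add: \<Phi>_def)
    qed
    have "wp (supported C) ?Q T' (For (\<lambda>s. nbrs G C (cur s)) (\<lambda>v.
          Cond (\<lambda>s. v \<in> R s \<and> v \<notin> comp s)
            (Basic (\<lambda>s. s\<lparr>comp := insert v (comp s)\<rparr>) ;; push v)
            Skip)) ?t1" if T': "T' + 3 = T" for T'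
    proof (rule wp_For[where \<phi> = \<Phi> and b = "\<lambda>_. 5" and J = "\<lambda>_ s'. set (queue s') \<subseteq> comp s'"])
      \<comment> \<open>The additional 2 cover the discarded \<open>Skip\<close> and the next loop
        test.\<close>
      have *: "\<Phi> ?t1 + (\<Sum>x\<in>nbrs G C (cur ?t1). 5 + 2) + 2 + 2 \<le> T'"
        using T' inv split by (simp add: visit_cost_def)
      then show "\<Phi> ?t1 + (\<Sum>x\<in>nbrs G C (cur ?t1). 5 + 2) + 2 \<le> T'" by linarith
      fix p t' assume "set (queue t') \<subseteq> comp t'"
        "T' - (\<Phi> ?t1 + (\<Sum>x\<in>nbrs G C (cur ?t1). 5 + 2) + 2) + \<Phi> t' \<le> p"
      then show "?Q p t'" using * by linarith
    qed (use t1 inv us finite_nbrs nbrs_subset[of G C u] in \<open>auto intro!: relax\<close>)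
    then show "wp (supported C) ?Q (T - 1) (pop ;; For (\<lambda>s. nbrs G C (cur s)) (\<lambda>v.
          Cond (\<lambda>s. v \<in> R s \<and> v \<notin> comp s)
            (Basic (\<lambda>s. s\<lparr>comp := insert v (comp s)\<rparr>) ;; push v)
            Skip)) t"
      unfolding pop_def using t t1 us inv split
      by (intro wp_Seq_Basic) (auto simp: visit_cost_def)
  qed (use that in auto)
  let ?s1 = "s\<lparr>queue := []\<rparr>" and ?s2 = "s\<lparr>queue := [q]\<rparr>" and ?s3 = "s\<lparr>queue := [q], comp := {q}\<rparr>"
  have s123: "supported C ?s1" "supported C ?s2" "supported C ?s3" using s q_in_C by (auto simp: supported_def)
  have "\<Phi> ?s3 = (\<Sum>u\<in>C. visit_cost u)"
    using q_in_C by (auto simp: \<Phi>_def intro: arg_cong[where f = "sum visit_cost"])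
  then have \<Phi>: "3 * length (queue s) + 8 + \<Phi> ?s3 \<le> round_cost"
    using length_queue_le[OF s] sum_visit_cost by (simp add: round_cost_def)
  show ?thesis
    unfolding reduce_component_def
  proof (rule wp_Seq_call[OF wp_clear_queue[OF s]])
    fix p t T1 assume t: "t = s\<lparr>queue := []\<rparr>" and T1: "T1 + (3 * length (queue s) + 1) + 1 = round_cost + p"
    show "wp (supported C) (\<lambda>_ _. True) T1 (push q ;; Basic (\<lambda>s. s\<lparr>comp := {q}\<rparr>) ;; ?search) t"
      unfolding t
    proof (rule wp_Seq_call[OF wp_push[OF s123(1) q_in_C]])
      fix p t T2 assume t: "t = ?s1\<lparr>queue := if q \<in> set (queue ?s1) then queue ?s1 else queue ?s1 @ [q]\<rparr>"
        and T2: "T2 + 2 + 1 = T1 + p"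
      then have t: "t = ?s2" by simp
      show "wp (supported C) (\<lambda>_ _. True) T2 (Basic (\<lambda>s. s\<lparr>comp := {q}\<rparr>) ;; ?search) t"
        unfolding t using s123 T1 T2 \<Phi> by (intro wp_Seq_Basic search) auto
    qed (use T1 \<Phi> in auto)
  qed (use \<Phi> in auto)
qed

section \<open>Setup phase and the whole program\<close>

definition rho_init :: "'v \<Rightarrow> real" where
  "rho_init u = (\<Sum>v\<in>nbrs G C u. tppr v)"

text \<open>Per vertex: 3 for filling \<open>R\<close>, 6 for its entry of \<open>rho\<close>, 3 for
  maximum and minimum; 3 per adjacency entry.\<close>

definition setup_cost :: nat where
  "setup_cost = 12 * card C + 3 * (\<Sum>u\<in>C. deg u) + 20"

lemma wp_fill_R:
  assumes "supported C s" "R s = {}"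
  shows "wp (supported C) (\<lambda>_ t. R t = C) (3 * card C + 2)
     (For (\<lambda>_. C) (\<lambda>u. Basic (\<lambda>s. s\<lparr>R := insert u (R s)\<rparr>))) s"
  by (rule wp_For[where J = "\<lambda>X t. R t = X" and \<phi> = "\<lambda>_. 0" and b = "\<lambda>_. 1"])
     (use assms finite_C in \<open>auto simp: supported_def intro!: wp_Basic\<close>)

lemma wp_sum_neighbours:
  assumes s: "supported C s" "R s = C" "\<forall>w\<in>X. rho s w = Some (rho_init w)" and u: "u \<in> C" "u \<notin> X"
  shows "wp (supported C) (\<lambda>_ t. R t = C \<and> (\<forall>w\<in>insert u X. rho t w = Some (rho_init w)))
     (4 + 3 * deg u)
     (Basic (\<lambda>s. s\<lparr>rho := (rho s)(u \<mapsto> 0)\<rparr>) ;;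
      For (\<lambda>_. nbrs G C u) (\<lambda>v. Basic (\<lambda>s. s\<lparr>rho := (rho s)(u \<mapsto> the (rho s u) + tppr v)\<rparr>))) s"
proof (rule wp_Seq_Basic)
  show "supported C s" by (rule s)
  show sup: "supported C (s\<lparr>rho := (rho s)(u \<mapsto> 0)\<rparr>)" using s u by (auto simp: supported_def)
  fix T assume T: "T + 2 = 4 + 3 * deg u"
  show "wp (supported C) (\<lambda>_ t. R t = C \<and> (\<forall>w\<in>insert u X. rho t w = Some (rho_init w))) T
     (For (\<lambda>_. nbrs G C u) (\<lambda>v. Basic (\<lambda>s. s\<lparr>rho := (rho s)(u \<mapsto> the (rho s u) + tppr v)\<rparr>)))
     (s\<lparr>rho := (rho s)(u \<mapsto> 0)\<rparr>)"
  proof (rule wp_For[where \<phi> = "\<lambda>_. 0" and b = "\<lambda>_. 1" and J = "\<lambda>Y t. R t = C \<and>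
        (\<forall>w\<in>X. rho t w = Some (rho_init w)) \<and> rho t u = Some (\<Sum>v\<in>Y. tppr v)"])
    fix Y v t
    assume t: "supported C t" "R t = C \<and> (\<forall>w\<in>X. rho t w = Some (rho_init w)) \<and> rho t u = Some (\<Sum>v\<in>Y. tppr v)"
      and Y: "Y \<subseteq> nbrs G C u" "v \<in> nbrs G C u" "v \<notin> Y"
    have "finite Y" using Y(1) finite_nbrs by (rule finite_subset)
    then show "wp (supported C) (\<lambda>p t'. 0 \<le> p \<and> R t' = C \<and> (\<forall>w\<in>X. rho t' w = Some (rho_init w)) \<and>
        rho t' u = Some (\<Sum>v\<in>insert v Y. tppr v)) (0 + 1)
        (Basic (\<lambda>s. s\<lparr>rho := (rho s)(u \<mapsto> the (rho s u) + tppr v)\<rparr>)) t"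
      using t Y(3) u by (intro wp_Basic) (auto simp: supported_def)
  qed (use s u sup T finite_nbrs in \<open>auto simp: rho_init_def\<close>)
qed simp

lemma wp_fill_rho:
  assumes "supported C s" "R s = C"
  shows "wp (supported C) (\<lambda>_ t. R t = C \<and> (\<forall>w\<in>C. rho t w = Some (rho_init w)))
     (6 * card C + 3 * (\<Sum>u\<in>C. deg u) + 2)
     (For (\<lambda>_. C) (\<lambda>u.
       Basic (\<lambda>s. s\<lparr>rho := (rho s)(u \<mapsto> 0)\<rparr>) ;;
       For (\<lambda>_. nbrs G C u) (\<lambda>v.
         Basic (\<lambda>s. s\<lparr>rho := (rho s)(u \<mapsto> the (rho s u) + tppr v)\<rparr>)))) s"
proof (rule wp_For[where \<phi> = "\<lambda>_. 0" and b = "\<lambda>u. 4 + 3 * deg u" and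
      J = "\<lambda>X t. R t = C \<and> (\<forall>w\<in>X. rho t w = Some (rho_init w))"])
  show "0 + (\<Sum>x\<in>C. 4 + 3 * deg x + 2) + 2 \<le> 6 * card C + 3 * (\<Sum>u\<in>C. deg u) + 2"
    by (simp add: sum.distrib sum_distrib_left)
  fix X u t
  assume "supported C t" "R t = C \<and> (\<forall>w\<in>X. rho t w = Some (rho_init w))" "u \<in> C" "u \<notin> X"
  then show "wp (supported C) (\<lambda>p t'. 0 \<le> p \<and> R t' = C \<and> (\<forall>w\<in>insert u X. rho t' w = Some (rho_init w)))
      (0 + (4 + 3 * deg u))
      (Basic (\<lambda>s. s\<lparr>rho := (rho s)(u \<mapsto> 0)\<rparr>) ;;
       For (\<lambda>_. nbrs G C u) (\<lambda>v. Basic (\<lambda>s. s\<lparr>rho := (rho s)(u \<mapsto> the (rho s u) + tppr v)\<rparr>))) t"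
    by (intro wp_call[OF wp_sum_neighbours[of t X u]]) simp_all
qed (use assms finite_C in simp_all)

text \<open>Two facts about the extremes carry the analysis: the maximum dominates the value at
  \<open>q\<close>, which makes \<open>temp\<close> nonnegative, and the minimum is attained, so the
  ratio hypothesis applies to it.\<close>

lemma wp_hi_lo:
  assumes s: "supported C s" "R s = C" "\<forall>w\<in>C. rho s w = Some (rho_init w)"
    "hi s = rho_init q" "lo s = rho_init q"
  shows "wp (supported C) (\<lambda>_ t. R t = C \<and> rho t q = Some (rho_init q) \<and>
       rho_init q \<le> hi t \<and> lo t \<in> rho_init ` C) (3 * card C + 2)
     (For (\<lambda>_. C) (\<lambda>u.
       Basic (\<lambda>s. s\<lparr>hi := max (hi s) (the (rho s u)), lo := min (lo s) (the (rho s u))\<rparr>))) s"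
proof (rule wp_For[where \<phi> = "\<lambda>_. 0" and b = "\<lambda>_. 1" and
      J = "\<lambda>_ t. R t = C \<and> (\<forall>w\<in>C. rho t w = Some (rho_init w)) \<and> rho_init q \<le> hi t \<and> lo t \<in> rho_init ` C"])
  fix X u t
  assume t: "supported C t" "R t = C \<and> (\<forall>w\<in>C. rho t w = Some (rho_init w)) \<and>
      rho_init q \<le> hi t \<and> lo t \<in> rho_init ` C" and u: "u \<in> C"
  then have "min (lo t) (the (rho t u)) \<in> rho_init ` C" by (simp add: min_def)
  with t u show "wp (supported C) (\<lambda>p t'. 0 \<le> p \<and> R t' = C \<and> (\<forall>w\<in>C. rho t' w = Some (rho_init w)) \<and>
      rho_init q \<le> hi t' \<and> lo t' \<in> rho_init ` C) (0 + 1)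
      (Basic (\<lambda>s. s\<lparr>hi := max (hi s) (the (rho s u)), lo := min (lo s) (the (rho s u))\<rparr>)) t"
    by (intro wp_Basic) (simp_all add: supported_def le_max_iff_disj)
qed (use s q_in_C finite_C in simp_all)

lemma wp_reduce_setup:
  "wp (supported C) (\<lambda>_ t. R t = C \<and> rho t q = Some (rho_init q) \<and> rho_init q \<le> hi t \<and>
       lo t \<in> rho_init ` C \<and> temp t = hi t + total_res G r \<and> eps_bar t = temp t / lo t)
     setup_cost (reduce_setup G C r tppr q) (reduce_init q)" (is "wp _ ?Q _ _ _")
proof -
  have s0: "supported C (reduce_init q)" "R (reduce_init q) = {}"
    using q_in_C by (simp_all add: supported_def reduce_init_def)
  have final: "wp (supported C) ?Q T (Basic (\<lambda>s. s\<lparr>temp := hi s + total_res G r\<rparr>) ;;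
      Basic (\<lambda>s. s\<lparr>eps_bar := temp s / lo s\<rparr>)) t"
    if "supported C t" "R t = C \<and> rho t q = Some (rho_init q) \<and> rho_init q \<le> hi t \<and> lo t \<in> rho_init ` C"
      "3 \<le> T" for t T
    using that by (intro wp_Seq_Basic wp_Basic) (auto simp: supported_def)
  show ?thesis
    unfolding reduce_setup_def
  proof (rule wp_Seq_call[OF wp_fill_R[OF s0]], goal_cases)
    case (2 p1 t1 T1)
    have sup1: "supported C (t1\<lparr>flag := True\<rparr>)" "R (t1\<lparr>flag := True\<rparr>) = C"
      using 2(1,2) by (simp_all add: supported_def)
    show ?case
    proof (rule wp_Seq_Basic, goal_cases)
      case (4 T2)
      show ?case
      proof (rule wp_Seq_call[OF wp_fill_rho[OF sup1]], goal_cases)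
        case c3: (2 p3 t3 T3)
        let ?t4 = "t3\<lparr>hi := the (rho t3 q), lo := the (rho t3 q)\<rparr>"
        have t4: "supported C ?t4" "R ?t4 = C" "\<forall>w\<in>C. rho ?t4 w = Some (rho_init w)"
          "hi ?t4 = rho_init q" "lo ?t4 = rho_init q"
          using c3(1,2) q_in_C by (simp_all add: supported_def)
        show ?case
        proof (rule wp_Seq_Basic, goal_cases)
          case c4: (4 T4)
          show ?case
          proof (rule wp_Seq_call[OF wp_hi_lo[OF t4]], goal_cases)
            case c5: (2 p5 t5 T5)
            then show ?case using c4 c3(3) 4 2(3) by (intro final) (simp_all add: setup_cost_def)
          qed (use c4 c3(3) 4 2(3) in \<open>simp add: setup_cost_def\<close>)
        qed (use t4 c3 4 2(3) in \<open>simp_all add: setup_cost_def\<close>)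
      qed (use 4 2(3) in \<open>simp_all add: setup_cost_def\<close>)
    qed (use 2 sup1 in \<open>simp_all add: setup_cost_def\<close>)
  qed (simp add: setup_cost_def)
qed

lemma rho_init_nonneg: "0 \<le> rho_init u"
  by (simp add: rho_init_def sum_nonneg tppr_nonneg)

text \<open>\<open>temp\<close> cancels in the stopping condition, so the number of rounds is
  governed by the ratio of the value at \<open>q\<close> to the smallest value.\<close>

lemma wp_reducing:
  assumes tot: "0 \<le> total_res G r"
    and ratio: "\<And>u. u \<in> C \<Longrightarrow> rho_init u \<noteq> 0 \<Longrightarrow> rho_init q \<le> 2 ^ N * rho_init u"
  shows "wp (supported C) (\<lambda>_ _. True)
     (setup_cost + (N + 1) * (round_cost + 2) + round_cost + 3)
     (reducing G C r tppr q) (reduce_init q)"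
  unfolding reducing_def
proof (rule wp_Seq_call[OF wp_reduce_setup], goal_cases)
  case (2 p t T)
  have t: "supported C t" "rho t q = Some (rho_init q)" "R t = C" "rho_init q \<le> hi t"
    "lo t \<in> rho_init ` C" "temp t = hi t + total_res G r" "eps_bar t = temp t / lo t"
    using 2 by auto
  have temp: "0 \<le> temp t" using tot t(4,6) rho_init_nonneg[of q] by linarith
  have lo: "0 \<le> lo t" using t(5) rho_init_nonneg by auto
  have eps: "0 \<le> eps_bar t" using temp lo t(7) by simp
  have "eps_bar t / 2 ^ N * rho_init q \<le> temp t"
  \<comment> \<open>For \<open>lo t = 0\<close> the quotient \<open>eps_bar\<close> is 0 by
    convention, and the claim reduces to \<open>temp\<close> being nonnegative.\<close>
  proof (cases "lo t = 0")
    case False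
    then have "rho_init q \<le> 2 ^ N * lo t" using t(5) ratio by auto
    then have "temp t * rho_init q \<le> temp t * (2 ^ N * lo t)" using temp by (rule mult_left_mono)
    then show ?thesis using False lo by (simp add: t(7) divide_simps mult_ac)
  qed (use temp t(7) in simp)
  moreover have "round_invar (temp t) (eps_bar t) (rho_init q) t"
    using t q_in_C by (simp add: round_invar_def)
  ultimately have loop: "wp (supported C) (\<lambda>_ _. True) ((N + 1) * (round_cost + 2) + 1)
      (reduce_loop G C tppr q) t"
    using t(1) eps by (intro wp_reduce_loop)
  show ?case
  proof (rule wp_Seq_call[OF loop], goal_cases)
    case c: (2 p' t' T')
    then show ?case using 2(3) by (intro wp_call[OF wp_reduce_component]) auto
  qed (use 2(3) in auto)
qed auto

end

section \<open>Bounds in the size of the induced graph\<close>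

lemma reducing_input_wp:
  assumes inp: "reducing_input G q \<alpha> C r tppr"
    and N: "2 * real (card (tedges G)) ^ 2 \<le> 2 ^ N"
  shows "wp (supported C) (\<lambda>_ _. True) (300 * (N + 1) * card (induced_edges G C))
     (reducing G C r tppr q) (reduce_init q)"
proof -
  note bounds = expanding_output_bounds[OF inp]
  interpret reducing_run G C tppr q
    using bounds by unfold_locales auto
  let ?m = "real (card (tedges G))" and ?E = "card (induced_edges G C)"
  have wf: "wf_temporal_graph G" and \<alpha>: "0 < \<alpha>" using inp by (auto simp: reducing_input_def)
  have finV: "finite (verts G)" using wf by (simp add: wf_temporal_graph_def)
  have "nbrs G C q \<subseteq> verts G"
    using edges_subset_verts[OF wf] by (auto simp: nbrs_def)
  then have "rho_init q \<le> (\<Sum>v\<in>verts G. tppr v)"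
    unfolding rho_init_def using finV by (intro sum_mono2) (auto intro: bounds)
  then have hi: "rho_init q \<le> 2 * \<alpha> * ?m" using bounds(7) by linarith
  have m: "1 \<le> ?m" using bounds(9) by simp
  have ratio: "rho_init q \<le> 2 ^ N * rho_init u" if u: "rho_init u \<noteq> 0" for u
  proof -
    \<comment> \<open>A nonzero sum has a nonzero term, which by granularity is at least
      \<open>\<alpha> / ?m\<close>.\<close>
    obtain v where v: "v \<in> nbrs G C u" "tppr v \<noteq> 0"
      using u unfolding rho_init_def by (meson sum.not_neutral_contains_not_neutral)
    have "\<alpha> / ?m \<le> tppr v" using bounds(6)[of v] v(2) by simp
    also have "\<dots> \<le> rho_init u"
      unfolding rho_init_def using v(1) by (intro member_le_sum) (auto simp: finite_nbrs tppr_nonneg)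
    finally have lb: "\<alpha> / ?m \<le> rho_init u" .
    \<comment> \<open>Here \<alpha> cancels: an upper bound proportional to \<alpha> meets a lower
      bound proportional to \<alpha>.\<close>
    have "2 * \<alpha> * ?m = (2 * ?m ^ 2) * (\<alpha> / ?m)" using m by (simp add: power2_eq_square)
    also have "\<dots> \<le> 2 ^ N * rho_init u" using N lb \<alpha> by (intro mult_mono) auto
    finally show ?thesis using hi by linarith
  qed
  have deg: "(\<Sum>u\<in>C. card (nbrs G C u)) \<le> 2 * ?E" by (rule sum_card_nbrs[OF wf bounds(1)])
  \<comment> \<open>Tree bound and existence of an edge give \<open>card C \<le> 2 * ?E\<close>;
    with the degree sum this yields 24 + 6 + 20 = 50 and 60 + 32 + 20 = 112.\<close>
  have sc: "setup_cost \<le> 50 * ?E" and rc: "round_cost \<le> 112 * ?E"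
    using bounds(3,4) deg by (simp_all add: setup_cost_def round_cost_def)
  have "(N + 1) * (round_cost + 2) \<le> (N + 1) * (114 * ?E)"
    using rc bounds(4) by (intro mult_le_mono2) linarith
  then have "setup_cost + (N + 1) * (round_cost + 2) + round_cost + 3 \<le> 165 * ?E + (N + 1) * (114 * ?E)"
    using sc rc bounds(4) by linarith
  also have "\<dots> \<le> 300 * (N + 1) * ?E" by (simp add: algebra_simps)
  finally show ?thesis
    by (intro wp_call[OF wp_reducing[OF bounds(5) ratio]]) auto
qed

text \<open>Seven containers of at most \<open>card C\<close> cells, the adjacency lists and 11
  scalars: at most 9 times the number of edges plus 18, and there is at least one edge.\<close>

lemma reduce_cells_le:
  assumes inp: "reducing_input G q \<alpha> C r tppr" and s: "supported C s"
  shows "reduce_cells G C s \<le> 27 * card (induced_edges G C)"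
proof -
  note bounds = expanding_output_bounds[OF inp]
  have wf: "wf_temporal_graph G" using inp by (auto simp: reducing_input_def)
  have "card X \<le> card C" if "X \<subseteq> C" for X using bounds(1) that by (rule card_mono)
  moreover have "length (queue s) = card (set (queue s))"
    using s by (simp add: supported_def distinct_card)
  ultimately have "card (R s) \<le> card C" "card (dom (rho s)) \<le> card C" "length (queue s) \<le> card C"
    "card (D s) \<le> card C" "card (comp s) \<le> card C"
    using s by (simp_all add: supported_def)
  then show ?thesis
    using bounds(3,4) sum_card_nbrs[OF wf bounds(1)] unfolding reduce_cells_def by linarith
qed

text \<open>The witness is \<open>2 * k + 1\<close> for \<open>k\<close> the rounded-up logarithm:
  squaring doubles the exponent and the factor 2 adds one.\<close>

lemma rounds_exist:
  assumes "1 \<le> m"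
  shows "\<exists>N. 2 * real m ^ 2 \<le> 2 ^ N \<and> real N \<le> 2 * log 2 (real m) + 3"
proof -
  define k where "k = nat \<lceil>log 2 (real m)\<rceil>"
  have log: "0 \<le> log 2 (real m)" using assms by simp
  have "log 2 (real m) \<le> real k" by (simp add: k_def real_nat_ceiling_ge)
  then have "real m \<le> 2 ^ k" using assms by (simp add: log_le_iff powr_realpow)
  then have "real m ^ 2 \<le> (2 ^ k) ^ 2" by (intro power_mono) auto
  then have "2 * real m ^ 2 \<le> 2 ^ (2 * k + 1)" by (simp add: power_mult[symmetric] mult.commute)
  moreover have "real k \<le> log 2 (real m) + 1" using log by (simp add: k_def)
  then have "real (2 * k + 1) \<le> 2 * log 2 (real m) + 3" by simp
  ultimately show ?thesis by blast
qed

theorem theorem4: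
  shows "(\<exists>c::real. \<forall>(G :: 'v temporal_graph) q \<alpha> C r tppr.
            reducing_input G q \<alpha> C r tppr \<and> card (tedges G) \<ge> 2 \<longrightarrow>
            runs_in_time (reducing G C r tppr q) (reduce_init q)
              (c * (real (card (induced_edges G C)) * log 2 (real (card (tedges G)))))) \<and>
         (\<exists>c::real. \<forall>(G :: 'v temporal_graph) q \<alpha> C r tppr.
            reducing_input G q \<alpha> C r tppr \<longrightarrow>
            runs_in_space (reduce_cells G C) (reducing G C r tppr q) (reduce_init q)
              (c * real (card (induced_edges G C))))"
proof (rule conjI; rule exI; intro allI impI)
  fix G :: "'v temporal_graph" and q \<alpha> C r tppr
  assume inp: "reducing_input G q \<alpha> C r tppr \<and> card (tedges G) \<ge> 2"
  let ?L = "log 2 (real (card (tedges G)))" and ?E = "real (card (induced_edges G C))"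
  obtain N where N: "2 * real (card (tedges G)) ^ 2 \<le> 2 ^ N" "real N \<le> 2 * ?L + 3"
    using rounds_exist[of "card (tedges G)"] inp by auto
  \<comment> \<open>With at least two temporal edges the logarithm is at least 1 and absorbs the
    additive constant: 300 times \<open>2 * ?L + 4\<close> is at most 1800 times
    \<open>?L\<close>.\<close>
  have "1 \<le> ?L" using inp by (simp add: le_log_iff)
  then have "300 * (real N + 1) \<le> 1800 * ?L" using N(2) by simp
  then have "300 * (real N + 1) * ?E \<le> 1800 * ?L * ?E" by (rule mult_right_mono) simp
  then have le: "real (300 * (N + 1) * card (induced_edges G C)) \<le> 1800 * (?E * ?L)"
    by (simp add: algebra_simps)
  have "runs_in_time (reducing G C r tppr q) (reduce_init q)
      (real (300 * (N + 1) * card (induced_edges G C)))"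
    using inp N(1) by (intro wp_runs_in_time[OF reducing_input_wp]) auto
  then show "runs_in_time (reducing G C r tppr q) (reduce_init q) (1800 * (?E * ?L))"
    unfolding runs_in_time_def using le by (blast intro: order_trans)
next
  fix G :: "'v temporal_graph" and q \<alpha> C r tppr
  assume inp: "reducing_input G q \<alpha> C r tppr"
  \<comment> \<open>Any sufficient supply of credits will do, since the space bound comes from
    \<open>supported\<close> alone.\<close>
  obtain N where N: "2 * real (card (tedges G)) ^ 2 \<le> 2 ^ N"
    using rounds_exist[OF expanding_output_bounds(9)[OF inp]] by blast
  have cells: "real (reduce_cells G C s) \<le> 27 * real (card (induced_edges G C))" if "supported C s" for s
    using reduce_cells_le[OF inp that] by linarith
  show "runs_in_space (reduce_cells G C) (reducing G C r tppr q) (reduce_init q)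
      (27 * real (card (induced_edges G C)))"
    by (rule wp_runs_in_space[OF reducing_input_wp[OF inp N] cells])
qed

end
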